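(* Let $M$ be a simple rank 3 matroid, let $\Gamma_M$ be its Levi graph with arbitrary positive edge lengths, let $D_M$ be its Cartwright divisor, and let $\Sigma\subseteq R(D_M)$ be a tropical linear series of dimension 2. Then $D_M\in|\Sigma|$ and $M_\Sigma$ is an adjoint of $M$.
   Context: Levi graph: let $M$ be a simple rank 3 matroid on a finite set $E$ and $H$ its set of rank 2 flats. $\Gamma_M$ is the bipartite graph with vertex set $E\sqcup H$ and an edge $[e,F]$ whenever $e\in F$, considered as a metric graph with arbitrary positive real edge lengths. The Cartwright divisor is $D_M=\sum_{e\in E}e$. The connected components of $\Gamma_M\smallsetminus\mathrm{supp}(D_M)$ are the open subgraphs $\gamma_F$, $F\in H$, consisting of the vertex $F$ and the interiors of its adjacent edges; the set of these components is identified with $H$. On a metric graph $\Gamma$: a divisor $D$ is a finite formal $\mathbb Z$-combination of points; effective ($\ge0$) means all coefficients are nonnegative; $\mathrm{supp}(D)$ is the set of points with nonzero coefficient. $\mathrm{PL}(\Gamma)$ is the set of continuous piecewise-linear functions with integer slopes; $\mathrm{div}(\varphi)$ has multiplicity at $p$ the sum of the incoming slopes (minus the sum of the outgoing slopes) of $\varphi$ at $p$; $R(D)=\{\varphi\in\mathrm{PL}(\Gamma):D+\mathrm{div}(\varphi)\ge0\}$. A tropical submodule of $R(D)$ is a subset closed under pointwise minimum and addition of real constants; it is finitely generated if it consists of all finite combinations $\min_i\{\varphi_i+a_i\}$ of a finite set. $r_{\mathrm{BN}}(\Sigma)$ is the largest integer $r$ such that for every effective $D'$ of degree $r$ there is $\varphi\in\Sigma$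 with $D-D'+\mathrm{div}(\varphi)\ge0$. A finite set $\{\varphi_0,\dots,\varphi_s\}$ is tropically dependent if there are reals $a_i$ such that at every point of $\Gamma$ the minimum $\min_i\{\varphi_i+a_i\}$ is achieved at least twice, and independent otherwise; $r_{\mathrm{ind}}(\Sigma)$ is the size of the largest independent subset. A tropical linear series of dimension $r$ is a finitely generated $\Sigma\subseteq R(D)$ with $r_{\mathrm{BN}}(\Sigma)=r$, $r_{\mathrm{ind}}(\Sigma)=r+1$. $|\Sigma|=\{D+\mathrm{div}(\varphi):\varphi\in\Sigma\}$. Local matroid: for a tropical linear series $\Sigma\subseteq R(D_M)$, $M_\Sigma$ is the matroid on the set of connected components of $\Gamma_M\smallsetminus\mathrm{supp}(D_M)$ (identified with $H$) whose flats are the whole ground set and the sets $F_\varphi=\{F\in H:\gamma_F\not\subseteq\varphi_{\min}\}$, $\varphi\in\Sigma$, where $\varphi_{\min}$ is the set of points where $\varphi$ attains its minimum; in this setting this collection is always the lattice of flats of a matroid, of rank $\dim\Sigma+1$. Adjoint: for a simple rank $r$ matroid $M$ with set $H$ of corank 1 flats, an adjoint of $M$ is a rank $r$ matroid $W$ on $H$ such that, for each $k$ and each rank $k$ flat $F$ of $M$, the set $\{H_i\in H:F\subseteq H_i\}$ is a corank $k$ flat of $W$. *)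

theory Defs
  imports "HOL-Analysis.Analysis"
begin

section \<open>Matroids, presented by their flats\<close>

record 'a matroid =
  ground :: "'a set"
  flats :: "'a set set"

definition flat_covers :: "'a matroid \<Rightarrow> 'a set \<Rightarrow> 'a set \<Rightarrow> bool" where
  "flat_covers M F G \<longleftrightarrow> F \<in> flats M \<and> G \<in> flats M \<and> F \<subset> G \<and>
     \<not> (\<exists>K\<in>flats M. F \<subset> K \<and> K \<subset> G)"

text \<open>The usual axioms for the flats of a matroid on a finite set; the last one says that the
  flats covering a flat \<open>F\<close> partition the complement of \<open>F\<close>.\<close>

definition is_matroid :: "'a matroid \<Rightarrow> bool" where
  "is_matroid M \<longleftrightarrow>
     finite (ground M) \<and>
     flats M \<subseteq> Pow (ground M) \<and>
     ground M \<in> flats M \<and>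
     (\<forall>F\<in>flats M. \<forall>G\<in>flats M. F \<inter> G \<in> flats M) \<and>
     (\<forall>F\<in>flats M. \<forall>e\<in>ground M - F. \<exists>!G. flat_covers M F G \<and> e \<in> G)"

text \<open>No loops (the empty set is a flat) and no parallel elements (the singletons are flats).\<close>

definition simple_matroid :: "'a matroid \<Rightarrow> bool" where
  "simple_matroid M \<longleftrightarrow> is_matroid M \<and> {} \<in> flats M \<and> (\<forall>e\<in>ground M. {e} \<in> flats M)"

text \<open>The rank of a flat is its height in the lattice of flats: the largest \<open>k\<close> such that there
  is a chain \<open>F\<^sub>0 \<subset> \<dots> \<subset> F\<^sub>k = F\<close> of flats. The chains \<open>C\<close> below omit the top element \<open>F\<close>.\<close>

definition flat_rank :: "'a matroid \<Rightarrow> 'a set \<Rightarrow> nat" where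
  "flat_rank M F = Max (card ` {C. subset.chain {G \<in> flats M. G \<subset> F} C})"

definition matroid_rank :: "'a matroid \<Rightarrow> nat" where
  "matroid_rank M = flat_rank M (ground M)"

definition rank_flats :: "'a matroid \<Rightarrow> nat \<Rightarrow> 'a set set" where
  "rank_flats M k = {F \<in> flats M. flat_rank M F = k}"

definition corank_flats :: "'a matroid \<Rightarrow> nat \<Rightarrow> 'a set set" where
  "corank_flats M k = {F \<in> flats M. flat_rank M F + k = matroid_rank M}"

definition is_adjoint :: "'a matroid \<Rightarrow> 'a set matroid \<Rightarrow> bool" where
  "is_adjoint M W \<longleftrightarrow>
     is_matroid W \<and> ground W = corank_flats M 1 \<and> matroid_rank W = matroid_rank M \<and>
     (\<forall>k. \<forall>F\<in>rank_flats M k. {G \<in> corank_flats M 1. F \<subseteq> G} \<in> corank_flats W k)"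


section \<open>Metric graphs\<close>

text \<open>Finite graphs with edge lengths. The orientation of the edges is auxiliary: it only
  serves to parametrise the edge \<open>k\<close> by the interval from \<open>0\<close> (at \<open>tail \<Gamma> k\<close>) to
  \<open>len \<Gamma> k\<close> (at \<open>head \<Gamma> k\<close>).\<close>

record ('v, 'k) metric_graph =
  verts :: "'v set"
  edges :: "'k set"
  tail :: "'k \<Rightarrow> 'v"
  head :: "'k \<Rightarrow> 'v"
  len :: "'k \<Rightarrow> real"

datatype ('v, 'k) point = Vertex 'v | Interior 'k real

definition edge_interior :: "('v, 'k) metric_graph \<Rightarrow> 'k \<Rightarrow> ('v, 'k) point set" where
  "edge_interior \<Gamma> k = {Interior k t |t. 0 < t \<and> t < len \<Gamma> k}"

definition points :: "('v, 'k) metric_graph \<Rightarrow> ('v, 'k) point set" where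
  "points \<Gamma> = Vertex ` verts \<Gamma> \<union> (\<Union>k\<in>edges \<Gamma>. edge_interior \<Gamma> k)"

definition edge_point :: "('v, 'k) metric_graph \<Rightarrow> 'k \<Rightarrow> real \<Rightarrow> ('v, 'k) point" where
  "edge_point \<Gamma> k t =
     (if t \<le> 0 then Vertex (tail \<Gamma> k)
      else if t < len \<Gamma> k then Interior k t
      else Vertex (head \<Gamma> k))"


subsection \<open>Piecewise linear functions\<close>

definition int_piecewise_linear :: "real \<Rightarrow> (real \<Rightarrow> real) \<Rightarrow> bool" where
  "int_piecewise_linear L g \<longleftrightarrow>
     continuous_on {0..L} g \<and>
     (\<exists>B. finite B \<and>
        (\<forall>a b. 0 \<le> a \<longrightarrow> a < b \<longrightarrow> b \<le> L \<longrightarrow> {a<..<b} \<inter> B = {} \<longrightarrow>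
           (\<exists>(m::int) c. \<forall>t\<in>{a<..<b}. g t = of_int m * t + c)))"

text \<open>Since the graph carries the quotient topology obtained by gluing its closed edges,
  continuity is continuity along every closed edge. Functions on \<open>\<Gamma>\<close> are normalised to be
  \<open>undefined\<close> off \<open>points \<Gamma>\<close>, so that equality of functions is equality on \<open>\<Gamma>\<close>.\<close>

definition PL :: "('v, 'k) metric_graph \<Rightarrow> (('v, 'k) point \<Rightarrow> real) set" where
  "PL \<Gamma> = {\<phi> \<in> extensional (points \<Gamma>).
     \<forall>k\<in>edges \<Gamma>. int_piecewise_linear (len \<Gamma> k) (\<lambda>t. \<phi> (edge_point \<Gamma> k t))}"

definition min_locus ::
    "('v, 'k) metric_graph \<Rightarrow> (('v, 'k) point \<Rightarrow> real) \<Rightarrow> ('v, 'k) point set" where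
  "min_locus \<Gamma> \<phi> = {p \<in> points \<Gamma>. \<forall>q\<in>points \<Gamma>. \<phi> p \<le> \<phi> q}"


subsection \<open>Divisors\<close>

definition divisors :: "('v, 'k) metric_graph \<Rightarrow> (('v, 'k) point \<Rightarrow> int) set" where
  "divisors \<Gamma> = {D. finite {p. D p \<noteq> 0} \<and> {p. D p \<noteq> 0} \<subseteq> points \<Gamma>}"

definition divisor_degree :: "(('v, 'k) point \<Rightarrow> int) \<Rightarrow> int" where
  "divisor_degree D = (\<Sum>p | D p \<noteq> 0. D p)"

definition effective :: "(('v, 'k) point \<Rightarrow> int) \<Rightarrow> bool" where
  "effective D \<longleftrightarrow> (\<forall>p. D p \<ge> 0)"

text \<open>Slopes of a function in the direction of the parametrisation of an edge.\<close>

definition slope_right :: "(real \<Rightarrow> real) \<Rightarrow> real \<Rightarrow> int" where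
  "slope_right g t = (THE m::int. (g has_real_derivative of_int m) (at_right t))"

definition slope_left :: "(real \<Rightarrow> real) \<Rightarrow> real \<Rightarrow> int" where
  "slope_left g t = (THE m::int. (g has_real_derivative of_int m) (at_left t))"

text \<open>The sum of the incoming slopes at each point. An edge \<open>k\<close> arrives at its head with incoming
  slope the left slope at \<open>len \<Gamma> k\<close>, and at its tail with incoming slope minus the right slope at
  \<open>0\<close>; an interior point of an edge has one tangent direction of either kind.\<close>

definition principal_divisor ::
    "('v, 'k) metric_graph \<Rightarrow> (('v, 'k) point \<Rightarrow> real) \<Rightarrow> ('v, 'k) point \<Rightarrow> int" where
  "principal_divisor \<Gamma> \<phi> p =
     (if p \<notin> points \<Gamma> then 0
      else case p of
        Vertex v \<Rightarrow>
          (\<Sum>k | k \<in> edges \<Gamma> \<and> head \<Gamma> k = v. slope_left (\<lambda>s. \<phi> (edge_point \<Gamma> k s)) (len \<Gamma> k))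
          - (\<Sum>k | k \<in> edges \<Gamma> \<and> tail \<Gamma> k = v. slope_right (\<lambda>s. \<phi> (edge_point \<Gamma> k s)) 0)
      | Interior k t \<Rightarrow>
          slope_left (\<lambda>s. \<phi> (edge_point \<Gamma> k s)) t - slope_right (\<lambda>s. \<phi> (edge_point \<Gamma> k s)) t)"

definition R_space ::
    "('v, 'k) metric_graph \<Rightarrow> (('v, 'k) point \<Rightarrow> int) \<Rightarrow> (('v, 'k) point \<Rightarrow> real) set" where
  "R_space \<Gamma> D = {\<phi> \<in> PL \<Gamma>. effective (\<lambda>p. D p + principal_divisor \<Gamma> \<phi> p)}"

definition linear_system ::
    "('v, 'k) metric_graph \<Rightarrow> (('v, 'k) point \<Rightarrow> int) \<Rightarrow> (('v, 'k) point \<Rightarrow> real) set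
      \<Rightarrow> (('v, 'k) point \<Rightarrow> int) set" where
  "linear_system \<Gamma> D \<Sigma> = {(\<lambda>p. D p + principal_divisor \<Gamma> \<phi> p) |\<phi>. \<phi> \<in> \<Sigma>}"


subsection \<open>Tropical linear series\<close>

definition tropical_submodule ::
    "('v, 'k) metric_graph \<Rightarrow> (('v, 'k) point \<Rightarrow> int) \<Rightarrow> (('v, 'k) point \<Rightarrow> real) set \<Rightarrow> bool" where
  "tropical_submodule \<Gamma> D \<Sigma> \<longleftrightarrow>
     \<Sigma> \<subseteq> R_space \<Gamma> D \<and>
     (\<forall>\<phi>\<in>\<Sigma>. \<forall>\<psi>\<in>\<Sigma>. (\<lambda>p\<in>points \<Gamma>. min (\<phi> p) (\<psi> p)) \<in> \<Sigma>) \<and>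
     (\<forall>\<phi>\<in>\<Sigma>. \<forall>a::real. (\<lambda>p\<in>points \<Gamma>. \<phi> p + a) \<in> \<Sigma>)"

definition tropical_span ::
    "('v, 'k) metric_graph \<Rightarrow> (('v, 'k) point \<Rightarrow> real) set \<Rightarrow> (('v, 'k) point \<Rightarrow> real) set" where
  "tropical_span \<Gamma> S =
     {(\<lambda>p\<in>points \<Gamma>. Min ((\<lambda>\<phi>. \<phi> p + a \<phi>) ` T)) |T (a :: (('v, 'k) point \<Rightarrow> real) \<Rightarrow> real).
        finite T \<and> T \<noteq> {} \<and> T \<subseteq> S}"

definition finitely_generated ::
    "('v, 'k) metric_graph \<Rightarrow> (('v, 'k) point \<Rightarrow> real) set \<Rightarrow> bool" where
  "finitely_generated \<Gamma> \<Sigma> \<longleftrightarrow> (\<exists>S. finite S \<and> S \<subseteq> \<Sigma> \<and> \<Sigma> = tropical_span \<Gamma> S)"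

definition BN_property ::
    "('v, 'k) metric_graph \<Rightarrow> (('v, 'k) point \<Rightarrow> int) \<Rightarrow> (('v, 'k) point \<Rightarrow> real) set
      \<Rightarrow> int \<Rightarrow> bool" where
  "BN_property \<Gamma> D \<Sigma> r \<longleftrightarrow>
     (\<forall>D'\<in>divisors \<Gamma>. effective D' \<longrightarrow> divisor_degree D' = r \<longrightarrow>
        (\<exists>\<phi>\<in>\<Sigma>. effective (\<lambda>p. D p - D' p + principal_divisor \<Gamma> \<phi> p)))"

definition has_BN_rank ::
    "('v, 'k) metric_graph \<Rightarrow> (('v, 'k) point \<Rightarrow> int) \<Rightarrow> (('v, 'k) point \<Rightarrow> real) set
      \<Rightarrow> int \<Rightarrow> bool" where
  "has_BN_rank \<Gamma> D \<Sigma> r \<longleftrightarrow>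
     BN_property \<Gamma> D \<Sigma> r \<and> (\<forall>s. BN_property \<Gamma> D \<Sigma> s \<longrightarrow> s \<le> r)"

definition tropically_dependent ::
    "('v, 'k) metric_graph \<Rightarrow> (('v, 'k) point \<Rightarrow> real) set \<Rightarrow> bool" where
  "tropically_dependent \<Gamma> S \<longleftrightarrow>
     (\<exists>a :: (('v, 'k) point \<Rightarrow> real) \<Rightarrow> real. \<forall>p\<in>points \<Gamma>. \<exists>\<phi>\<in>S. \<exists>\<psi>\<in>S.
        \<phi> \<noteq> \<psi> \<and> \<phi> p + a \<phi> = \<psi> p + a \<psi> \<and> (\<forall>\<rho>\<in>S. \<phi> p + a \<phi> \<le> \<rho> p + a \<rho>))"

definition has_ind_rank ::
    "('v, 'k) metric_graph \<Rightarrow> (('v, 'k) point \<Rightarrow> real) set \<Rightarrow> nat \<Rightarrow> bool" where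
  "has_ind_rank \<Gamma> \<Sigma> n \<longleftrightarrow>
     (\<exists>S\<subseteq>\<Sigma>. finite S \<and> \<not> tropically_dependent \<Gamma> S \<and> card S = n) \<and>
     (\<forall>S\<subseteq>\<Sigma>. finite S \<longrightarrow> \<not> tropically_dependent \<Gamma> S \<longrightarrow> card S \<le> n)"

definition tropical_linear_series ::
    "('v, 'k) metric_graph \<Rightarrow> (('v, 'k) point \<Rightarrow> int) \<Rightarrow> nat \<Rightarrow> (('v, 'k) point \<Rightarrow> real) set
      \<Rightarrow> bool" where
  "tropical_linear_series \<Gamma> D r \<Sigma> \<longleftrightarrow>
     tropical_submodule \<Gamma> D \<Sigma> \<and> finitely_generated \<Gamma> \<Sigma> \<and>
     has_BN_rank \<Gamma> D \<Sigma> (int r) \<and> has_ind_rank \<Gamma> \<Sigma> (r + 1)"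


section \<open>Levi graphs and local matroids\<close>

definition levi_graph ::
    "'a matroid \<Rightarrow> ('a \<times> 'a set \<Rightarrow> real) \<Rightarrow> ('a + 'a set, 'a \<times> 'a set) metric_graph" where
  "levi_graph M l =
     \<lparr>verts = ground M <+> rank_flats M 2,
      edges = {(e, F). F \<in> rank_flats M 2 \<and> e \<in> F},
      tail = (\<lambda>(e, F). Inl e),
      head = (\<lambda>(e, F). Inr F),
      len = l\<rparr>"

definition cartwright_divisor ::
    "'a matroid \<Rightarrow> ('a + 'a set, 'a \<times> 'a set) point \<Rightarrow> int" where
  "cartwright_divisor M p = (\<Sum>e\<in>ground M. of_bool (p = Vertex (Inl e)))"

text \<open>The connected component of the complement of the support of the Cartwright divisor which
  contains the vertex \<open>F\<close>.\<close>

definition levi_component ::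
    "'a matroid \<Rightarrow> ('a \<times> 'a set \<Rightarrow> real) \<Rightarrow> 'a set \<Rightarrow> ('a + 'a set, 'a \<times> 'a set) point set" where
  "levi_component M l F =
     insert (Vertex (Inr F)) (\<Union>e\<in>F. edge_interior (levi_graph M l) (e, F))"

definition local_flat ::
    "'a matroid \<Rightarrow> ('a \<times> 'a set \<Rightarrow> real) \<Rightarrow> (('a + 'a set, 'a \<times> 'a set) point \<Rightarrow> real)
      \<Rightarrow> 'a set set" where
  "local_flat M l \<phi> =
     {F \<in> rank_flats M 2. \<not> levi_component M l F \<subseteq> min_locus (levi_graph M l) \<phi>}"

definition local_matroid ::
    "'a matroid \<Rightarrow> ('a \<times> 'a set \<Rightarrow> real) \<Rightarrow> (('a + 'a set, 'a \<times> 'a set) point \<Rightarrow> real) set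
      \<Rightarrow> 'a set matroid" where
  "local_matroid M l \<Sigma> =
     \<lparr>ground = rank_flats M 2,
      flats = insert (rank_flats M 2) (local_flat M l ` \<Sigma>)\<rparr>"

end

theory Submission
  imports Defs
begin

text \<open>
  The minimum locus of \<open>\<phi> \<in> R(D\<^sub>M)\<close> contains some point \<open>e\<close> of \<open>M\<close>, and if it contains \<open>e\<close> then it
  contains all lines through \<open>e\<close> except at most one; there is no exception if \<open>D\<^sub>M + div \<phi>\<close> has
  \<open>e\<close> in its support. If it meets the component of a line then it contains the whole component and
  all points of the line.

  Write \<open>X\<close> for the set of lines not contained in the minimum locus. Three degree 2 divisors give
  everything. Prescribing two points of a line \<open>F\<close> forces \<open>F \<notin> X\<close>; since the sets \<open>X\<close> are closed
  under intersection, \<open>\<emptyset>\<close> occurs, that is, \<open>\<Sigma>\<close> contains the constants. Prescribing a line \<open>F\<close> and a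
  point of \<open>G - F\<close> forces \<open>F \<in> X\<close> and \<open>G \<notin> X\<close>, so the singletons occur. Prescribing two lines
  through \<open>e\<close> forces \<open>X\<close> to be exactly the pencil of lines through \<open>e\<close>. Finally, functions with
  strictly nested sets \<open>X\<close> are tropically independent, so no chain has more than three members.
\<close>

section \<open>Piecewise linear functions on an interval\<close>

text \<open>Slopes are definite descriptions of one-sided derivatives. An affine germ supplies
  existence, and the nontriviality of the one-sided filter supplies uniqueness.\<close>

lemma slope_right_eqI:
  assumes "\<epsilon> > 0" "\<And>s. s \<in> {t..t+\<epsilon>} \<Longrightarrow> g s = g t + of_int m * (s - t)"
  shows "slope_right g t = m"
proof -
  have "((\<lambda>s. g t + of_int m * (s - t)) has_real_derivative of_int m) (at_right t)"
    by (auto intro!: derivative_eq_intros)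
  moreover have "eventually (\<lambda>s. s \<in> {t<..<t+\<epsilon>}) (at_right t)"
    using assms(1) by (intro eventually_at_right_real) simp
  then have "eventually (\<lambda>s. g t + of_int m * (s - t) = g s) (at_right t)"
  proof eventually_elim
    case (elim s)
    then show ?case using assms(2)[of s] by auto
  qed
  ultimately have "(g has_real_derivative of_int m) (at_right t)"
    by (subst (asm) has_field_derivative_cong_eventually) auto
  then show ?thesis
    unfolding slope_right_def
    by (intro the_equality) (auto dest: has_field_derivative_unique simp: trivial_limit_at_right_real)
qed

lemma slope_left_eqI:
  assumes "\<epsilon> > 0" "\<And>s. s \<in> {t-\<epsilon>..t} \<Longrightarrow> g s = g t + of_int m * (s - t)"
  shows "slope_left g t = m"
proof -
  have "((\<lambda>s. g t + of_int m * (s - t)) has_real_derivative of_int m) (at_left t)"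
    by (auto intro!: derivative_eq_intros)
  moreover have "eventually (\<lambda>s. s \<in> {t-\<epsilon><..<t}) (at_left t)"
    using assms(1) by (intro eventually_at_left_real) simp
  then have "eventually (\<lambda>s. g t + of_int m * (s - t) = g s) (at_left t)"
  proof eventually_elim
    case (elim s)
    then show ?case using assms(2)[of s] by auto
  qed
  ultimately have "(g has_real_derivative of_int m) (at_left t)"
    by (subst (asm) has_field_derivative_cong_eventually) auto
  then show ?thesis
    unfolding slope_left_def
    by (intro the_equality) (auto dest: has_field_derivative_unique simp: trivial_limit_at_left_real)
qed

text \<open>Constancy is asked on all of the real line. \<open>edge_point\<close> clamps its
  parameter, so a function constant on the graph satisfies this even beyond the ends of an
  edge.\<close>

lemma slope_const:
  assumes "\<And>s. g s = c"
  shows "slope_right g t = 0" "slope_left g t = 0"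
  by (rule slope_right_eqI[of 1], use assms in auto) (rule slope_left_eqI[of 1], use assms in auto)

text \<open>The definition yields affineness only on open intervals without breakpoints. Subtracting
  the affine function leaves a constant, which continuity carries to the end points.\<close>

lemma ipl_affine:
  fixes g :: "real \<Rightarrow> real"
  assumes g: "continuous_on {0..L} g"
    and B: "\<forall>a b. 0 \<le> a \<longrightarrow> a < b \<longrightarrow> b \<le> L \<longrightarrow> {a<..<b} \<inter> B = {} \<longrightarrow>
           (\<exists>(m::int) c. \<forall>t\<in>{a<..<b}. g t = of_int m * t + c)"
    and ab: "0 \<le> a" "a < b" "b \<le> L" "{a<..<b} \<inter> B = {}"
  shows "\<exists>(m::int) c. \<forall>t\<in>{a..b}. g t = of_int m * t + c"
proof -
  obtain m :: int and c where mc: "\<forall>t\<in>{a<..<b}. g t = of_int m * t + c"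
    using B ab by blast
  have "g t - of_int m * t = c" if "t \<in> {a..b}" for t
  proof (rule continuous_constant_on_closure[of "{a<..<b}" "\<lambda>t. g t - of_int m * t"])
    show "continuous_on (closure {a<..<b}) (\<lambda>t. g t - of_int m * t)"
      using ab by (auto intro!: continuous_intros continuous_on_subset[OF g])
  qed (use mc that ab in auto)
  then have "\<forall>t\<in>{a..b}. g t = of_int m * t + c" by (auto simp: algebra_simps)
  then show ?thesis by blast
qed

lemma ipl_right:
  assumes "int_piecewise_linear L g" "0 \<le> t" "t < L"
  shows "\<exists>\<epsilon>>0. t + \<epsilon> \<le> L \<and>
    (\<forall>s\<in>{t..t+\<epsilon>}. g s = g t + of_int (slope_right g t) * (s - t))"
proof -
  obtain B where g: "continuous_on {0..L} g" and fin: "finite B" and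
    B: "\<forall>a b. 0 \<le> a \<longrightarrow> a < b \<longrightarrow> b \<le> L \<longrightarrow> {a<..<b} \<inter> B = {} \<longrightarrow>
           (\<exists>(m::int) c. \<forall>t\<in>{a<..<b}. g t = of_int m * t + c)"
    using assms(1) unfolding int_piecewise_linear_def by blast
  obtain d where d: "d > 0" "\<forall>x\<in>B. x \<noteq> t \<longrightarrow> d \<le> dist t x"
    using finite_set_avoid[OF fin] by metis
  \<comment> \<open>Small enough to reach neither the next breakpoint nor beyond the end of the
    edge.\<close>
  define \<epsilon> where "\<epsilon> = min d (L - t)"
  have e: "\<epsilon> > 0" "t + \<epsilon> \<le> L" "{t<..<t+\<epsilon>} \<inter> B = {}"
    using d assms by (auto simp: \<epsilon>_def dist_real_def)
  obtain m :: int and c where mc: "\<forall>s\<in>{t..t+\<epsilon>}. g s = of_int m * s + c"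
    using ipl_affine[OF g B assms(2) _ e(2,3)] e(1) by auto
  then have aff: "g s = g t + of_int m * (s - t)" if "s \<in> {t..t+\<epsilon>}" for s
    using that e(1) by (auto simp: algebra_simps)
  have "slope_right g t = m"
    by (rule slope_right_eqI[OF e(1) aff])
  then have "\<forall>s\<in>{t..t+\<epsilon>}. g s = g t + of_int (slope_right g t) * (s - t)"
    using aff by metis
  then show ?thesis
    using e(1,2) by blast
qed

lemma ipl_left:
  assumes "int_piecewise_linear L g" "0 < t" "t \<le> L"
  shows "\<exists>\<epsilon>>0. 0 \<le> t - \<epsilon> \<and>
    (\<forall>s\<in>{t-\<epsilon>..t}. g s = g t + of_int (slope_left g t) * (s - t))"
proof -
  obtain B where g: "continuous_on {0..L} g" and fin: "finite B" and
    B: "\<forall>a b. 0 \<le> a \<longrightarrow> a < b \<longrightarrow> b \<le> L \<longrightarrow> {a<..<b} \<inter> B = {} \<longrightarrow>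
           (\<exists>(m::int) c. \<forall>t\<in>{a<..<b}. g t = of_int m * t + c)"
    using assms(1) unfolding int_piecewise_linear_def by blast
  obtain d where d: "d > 0" "\<forall>x\<in>B. x \<noteq> t \<longrightarrow> d \<le> dist t x"
    using finite_set_avoid[OF fin] by metis
  define \<epsilon> where "\<epsilon> = min d t"
  have e: "\<epsilon> > 0" "0 \<le> t - \<epsilon>" "{t-\<epsilon><..<t} \<inter> B = {}"
    using d assms by (auto simp: \<epsilon>_def dist_real_def)
  obtain m :: int and c where mc: "\<forall>s\<in>{t-\<epsilon>..t}. g s = of_int m * s + c"
    using ipl_affine[OF g B e(2) _ assms(3) e(3)] e(1) by auto
  then have aff: "g s = g t + of_int m * (s - t)" if "s \<in> {t-\<epsilon>..t}" for s
    using that e(1) by (auto simp: algebra_simps)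
  have "slope_left g t = m"
    by (rule slope_left_eqI[OF e(1) aff])
  then have "\<forall>s\<in>{t-\<epsilon>..t}. g s = g t + of_int (slope_left g t) * (s - t)"
    using aff by metis
  then show ?thesis
    using e(1,2) by blast
qed

section \<open>Propagation of a minimum along an edge\<close>

lemma ipl_min_slope_right:
  assumes "int_piecewise_linear L g" "0 \<le> t" "t < L" "\<And>s. s \<in> {0..L} \<Longrightarrow> g t \<le> g s"
  shows "0 \<le> slope_right g t"
proof -
  obtain \<epsilon> where e: "\<epsilon> > 0" "t + \<epsilon> \<le> L"
    "\<And>s. s \<in> {t..t+\<epsilon>} \<Longrightarrow> g s = g t + of_int (slope_right g t) * (s - t)"
    using ipl_right[OF assms(1-3)] by blast
  have "0 \<le> of_int (slope_right g t) * \<epsilon>"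
    using e(3)[of "t+\<epsilon>"] assms(4)[of "t+\<epsilon>"] e(1,2) assms(2) by simp
  then show ?thesis using e(1) by (simp add: zero_le_mult_iff)
qed

lemma ipl_min_slope_left:
  assumes "int_piecewise_linear L g" "0 < t" "t \<le> L" "\<And>s. s \<in> {0..L} \<Longrightarrow> g t \<le> g s"
  shows "slope_left g t \<le> 0"
proof -
  obtain \<epsilon> where e: "\<epsilon> > 0" "0 \<le> t - \<epsilon>"
    "\<And>s. s \<in> {t-\<epsilon>..t} \<Longrightarrow> g s = g t + of_int (slope_left g t) * (s - t)"
    using ipl_left[OF assms(1-3)] by blast
  have "0 \<le> - of_int (slope_left g t) * \<epsilon>"
    using e(3)[of "t-\<epsilon>"] assms(4)[of "t-\<epsilon>"] e(1,2) assms(3) by simp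
  then show ?thesis using e(1) by (simp add: zero_le_mult_iff mult_le_0_iff)
qed

text \<open>The assumption \<open>sub\<close> says that \<open>g\<close> is concave, and a concave
  function with an interior minimum is constant. The minimum points form a nonempty clopen subset of
  the connected open interval; continuity adds the two ends.\<close>

lemma ipl_min_const:
  assumes g: "int_piecewise_linear L g"
    and sub: "\<And>t. 0 < t \<Longrightarrow> t < L \<Longrightarrow> slope_right g t \<le> slope_left g t"
    and min: "\<And>s. s \<in> {0..L} \<Longrightarrow> g t0 \<le> g s"
    and t0: "0 < t0" "t0 < L"
    and s: "s \<in> {0..L}"
  shows "g s = g t0"
proof -
  let ?T = "{t\<in>{0<..<L}. g t = g t0}"
  have cont: "continuous_on {0..L} g"
    using g by (simp add: int_piecewise_linear_def)
  have "closedin (top_of_set {0<..<L}) ?T"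
    by (rule continuous_closedin_preimage_constant) (auto intro: continuous_on_subset[OF cont])
  moreover have "openin (top_of_set {0<..<L}) ?T"
  proof -
    have "open ?T"
      unfolding open_dist
    proof (intro ballI)
      fix t assume "t \<in> ?T"
      then have t: "0 < t" "t < L" "g t = g t0" by auto
      have mt: "g t \<le> g s" if "s \<in> {0..L}" for s using min[OF that] t by simp
      \<comment> \<open>Minimality makes the right slope nonnegative and the left slope nonpositive;
        concavity reverses the comparison, so both vanish.\<close>
      have sl: "slope_right g t = 0" "slope_left g t = 0"
        using ipl_min_slope_right[OF g _ t(2) mt] ipl_min_slope_left[OF g t(1) _ mt] sub[OF t(1,2)] t
        by auto
      obtain \<epsilon> where e: "\<epsilon> > 0" "t + \<epsilon> \<le> L"
        "\<And>s. s \<in> {t..t+\<epsilon>} \<Longrightarrow> g s = g t + of_int (slope_right g t) * (s - t)"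
        using ipl_right[OF g less_imp_le[OF t(1)] t(2)] by blast
      obtain \<delta> where d: "\<delta> > 0" "0 \<le> t - \<delta>"
        "\<And>s. s \<in> {t-\<delta>..t} \<Longrightarrow> g s = g t + of_int (slope_left g t) * (s - t)"
        using ipl_left[OF g t(1) less_imp_le[OF t(2)]] by blast
      have "y \<in> ?T" if y: "dist y t < min \<epsilon> \<delta>" for y
      proof (cases "t \<le> y")
        case True
        then show ?thesis using y t e(2) e(3)[of y] sl(1) by (auto simp: dist_real_def)
      next
        case False
        then show ?thesis using y t d(2) d(3)[of y] sl(2) by (auto simp: dist_real_def)
      qed
      then show "\<exists>e>0. \<forall>y. dist y t < e \<longrightarrow> y \<in> ?T"
        using e(1) d(1) by (intro exI[of _ "min \<epsilon> \<delta>"]) auto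
    qed
    then show ?thesis by (rule open_openin_trans[rotated 1]) auto
  qed
  moreover have "connected {0<..<L}" by simp
  ultimately have "?T = {} \<or> ?T = {0<..<L}"
    unfolding connected_clopen by (elim allE impE) (rule conjI)
  moreover have "t0 \<in> ?T"
    using t0 by simp
  ultimately have T: "?T = {0<..<L}"
    by blast
  have const: "g t = g t0" if "t \<in> {0<..<L}" for t
    using that T by blast
  show ?thesis
  proof (rule continuous_constant_on_closure[OF _ const])
    show "continuous_on (closure {0<..<L}) g" "s \<in> closure {0<..<L}"
      using t0 s cont by auto
  qed
qed

text \<open>A zero slope at the end moves the minimum a little into the edge, where the interior
  case applies. Half of \<open>\<epsilon>\<close> keeps the new point strictly inside.\<close>

lemma ipl_min_right_const:
  assumes g: "int_piecewise_linear L g" "0 < L"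
    and sub: "\<And>t. 0 < t \<Longrightarrow> t < L \<Longrightarrow> slope_right g t \<le> slope_left g t"
    and min: "\<And>s. s \<in> {0..L} \<Longrightarrow> g 0 \<le> g s"
    and "slope_right g 0 = 0" and s: "s \<in> {0..L}"
  shows "g s = g 0"
proof -
  obtain \<epsilon> where e: "\<epsilon> > 0" "0 + \<epsilon> \<le> L"
    "\<And>s. s \<in> {0..0+\<epsilon>} \<Longrightarrow> g s = g 0 + of_int (slope_right g 0) * (s - 0)"
    using ipl_right[OF g(1) order_refl g(2)] by blast
  have "g (\<epsilon>/2) = g 0" using e(3)[of "\<epsilon>/2"] e(1) assms(5) by simp
  then show ?thesis using ipl_min_const[OF g(1) sub _ _ _ s, of "\<epsilon>/2"] min e(1,2) by auto
qed

lemma ipl_min_left_const: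
  assumes g: "int_piecewise_linear L g" "0 < L"
    and sub: "\<And>t. 0 < t \<Longrightarrow> t < L \<Longrightarrow> slope_right g t \<le> slope_left g t"
    and min: "\<And>s. s \<in> {0..L} \<Longrightarrow> g L \<le> g s"
    and "slope_left g L = 0" and s: "s \<in> {0..L}"
  shows "g s = g L"
proof -
  obtain \<epsilon> where e: "\<epsilon> > 0" "0 \<le> L - \<epsilon>"
    "\<And>s. s \<in> {L-\<epsilon>..L} \<Longrightarrow> g s = g L + of_int (slope_left g L) * (s - L)"
    using ipl_left[OF g(1) g(2) order_refl] by blast
  have "g (L-\<epsilon>/2) = g L" using e(3)[of "L-\<epsilon>/2"] e(1) assms(5) by simp
  then show ?thesis using ipl_min_const[OF g(1) sub _ _ _ s, of "L-\<epsilon>/2"] min e(1,2) by auto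
qed

section \<open>Ranks of flats\<close>

text \<open>\<open>flat_rank\<close> is a \<open>Max\<close>, which has its meaning only on finite
  nonempty sets. Finiteness comes from here, nonemptiness from the empty chain.\<close>

lemma finite_chains:
  assumes "finite (flats M)"
  shows "finite {C. subset.chain {K \<in> flats M. K \<subset> F} C}"
  by (rule finite_subset[of _ "Pow (flats M)"]) (use assms in \<open>auto simp: subset.chain_def\<close>)

lemma flat_rank_leI:
  assumes "finite (flats M)"
    and "\<And>C. subset.chain {K \<in> flats M. K \<subset> F} C \<Longrightarrow> card C \<le> n"
  shows "flat_rank M F \<le> n"
proof -
  let ?R = "card ` {C. subset.chain {K \<in> flats M. K \<subset> F} C}"
  have "?R \<noteq> {}"
    by (auto simp: subset.chain_def intro: exI[of _ "{}"])
  then show ?thesis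
    unfolding flat_rank_def using assms(2) finite_chains[OF assms(1)] by (subst Max_le_iff) auto
qed

lemma flat_rank_chainE:
  assumes "finite (flats M)"
  obtains C where "subset.chain {K \<in> flats M. K \<subset> F} C" "card C = flat_rank M F"
proof -
  let ?R = "card ` {C. subset.chain {K \<in> flats M. K \<subset> F} C}"
  have "?R \<noteq> {}"
    by (auto simp: subset.chain_def intro: exI[of _ "{}"])
  then have "flat_rank M F \<in> ?R"
    unfolding flat_rank_def using finite_chains[OF assms] by (intro Max_in finite_imageI)
  then show ?thesis
    using that by auto
qed

text \<open>Putting \<open>F\<close> on top of a longest chain below \<open>F\<close> gives a longer
  chain below \<open>G\<close>.\<close>

lemma flat_rank_strict_mono:
  assumes "finite (flats M)" "F \<in> flats M" "F \<subset> G"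
  shows "flat_rank M F < flat_rank M G"
proof -
  obtain C where C: "subset.chain {K \<in> flats M. K \<subset> F} C" "card C = flat_rank M F"
    using flat_rank_chainE[OF assms(1)] by metis
  have "finite C"
    using C(1) assms(1) by (auto simp: subset.chain_def intro: finite_subset)
  moreover have "F \<notin> C"
    using C(1) by (auto simp: subset.chain_def)
  ultimately have "card (insert F C) = Suc (flat_rank M F)"
    using C(2) by simp
  moreover have "subset.chain {K \<in> flats M. K \<subset> G} (insert F C)"
    using C(1) assms(2,3) unfolding subset.chain_def by blast
  ultimately have "Suc (flat_rank M F) \<in> card ` {C. subset.chain {K \<in> flats M. K \<subset> G} C}"
    by (intro image_eqI[of _ _ "insert F C"]) auto
  then have "Suc (flat_rank M F) \<le> flat_rank M G"
    unfolding flat_rank_def[of M G] by (intro Max_ge finite_imageI finite_chains[OF assms(1)])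
  then show ?thesis
    by simp
qed


section \<open>Linear spaces\<close>

text \<open>A finite linear space of incidence geometry, with at least two points and no line
  containing all of them. This is what the arguments about sets of lines use of a simple rank 3
  matroid.\<close>

locale linear_space =
  fixes E :: "'a set" and H :: "'a set set"
  assumes finite_points: "finite E"
    and line_psubset: "F \<in> H \<Longrightarrow> F \<subset> E"
    and line_exists: "x \<in> E \<Longrightarrow> y \<in> E \<Longrightarrow> x \<noteq> y \<Longrightarrow> \<exists>F\<in>H. x \<in> F \<and> y \<in> F"
    and line_unique: "F \<in> H \<Longrightarrow> G \<in> H \<Longrightarrow> x \<in> F \<Longrightarrow> y \<in> F \<Longrightarrow> x \<in> G \<Longrightarrow> y \<in> G \<Longrightarrow> x \<noteq> y \<Longrightarrow> F = G"
    and line_two_points: "F \<in> H \<Longrightarrow> \<exists>x\<in>F. \<exists>y\<in>F. x \<noteq> y"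
    and two_points: "\<exists>x\<in>E. \<exists>y\<in>E. x \<noteq> y"
begin

lemma finite_lines: "finite H"
  by (rule finite_subset[of _ "Pow E"]) (use line_psubset finite_points in auto)

text \<open>A line through \<open>e\<close> misses some point, and joining \<open>e\<close> to that
  point gives a second line. This is what gives force to a bound of at most one exceptional line per
  point.\<close>

lemma two_lines_through:
  assumes "e \<in> E"
  obtains F G where "F \<in> H" "G \<in> H" "F \<noteq> G" "e \<in> F" "e \<in> G"
proof -
  obtain y where y: "y \<in> E" "y \<noteq> e"
    using two_points by metis
  obtain F where F: "F \<in> H" "e \<in> F" "y \<in> F"
    using line_exists[OF assms y(1)] y(2) by metis
  obtain z where z: "z \<in> E" "z \<notin> F"
    using line_psubset[OF F(1)] by auto
  then obtain G where "G \<in> H" "e \<in> G" "z \<in> G"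
    using line_exists[OF assms z(1)] F(2) by metis
  then show ?thesis
    using that F z(2) by metis
qed

lemma line_point_off:
  assumes "F \<in> H" "G \<in> H" "F \<noteq> G"
  obtains x where "x \<in> F" "x \<notin> G"
  using assms line_two_points line_unique by metis

end

lemma rank3_linear_space:
  assumes simple: "simple_matroid M" and rank: "matroid_rank M = 3"
  shows "linear_space (ground M) (rank_flats M 2)"
    and "rank_flats M 0 = {{}}"
    and "rank_flats M 1 = (\<lambda>e. {e}) ` ground M"
    and "rank_flats M 3 = {ground M}"
    and "\<And>k. rank_flats M k \<noteq> {} \<Longrightarrow> k \<le> 3"
proof -
  have mat: "is_matroid M" and empty: "{} \<in> flats M"
    and sing: "\<And>e. e \<in> ground M \<Longrightarrow> {e} \<in> flats M"
    using simple by (auto simp: simple_matroid_def)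
  have finE: "finite (ground M)" and sub: "\<And>F. F \<in> flats M \<Longrightarrow> F \<subseteq> ground M"
    and top: "ground M \<in> flats M"
    and int: "\<And>F G. F \<in> flats M \<Longrightarrow> G \<in> flats M \<Longrightarrow> F \<inter> G \<in> flats M"
    and cover: "\<And>F e. F \<in> flats M \<Longrightarrow> e \<in> ground M - F \<Longrightarrow> \<exists>!G. flat_covers M F G \<and> e \<in> G"
    using mat by (auto simp: is_matroid_def)
  have fin: "finite (flats M)"
    by (rule finite_subset[of _ "Pow (ground M)"]) (use sub finE in auto)
  note mono = flat_rank_strict_mono[OF fin]
  have rk: "flat_rank M (ground M) = 3"
    using rank by (simp add: matroid_rank_def)
  have r3: "F = ground M" if "F \<in> flats M" "flat_rank M F \<ge> 3" for F
    using mono[OF that(1), of "ground M"] sub[OF that(1)] that(2) rk by fastforce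
  have r1: "flat_rank M F \<ge> 1" if "F \<noteq> {}" for F
    using mono[OF empty, of F] that by fastforce
  have r2: "flat_rank M F \<ge> 2" if "F \<in> flats M" "x \<in> F" "y \<in> F" "x \<noteq> y" for F x y
    using mono[OF sing, of x F] r1[of "{x}"] sub[OF that(1)] that by fastforce
  have rs: "flat_rank M F = 2" if "F \<in> flats M" "x \<in> F" "y \<in> F" "x \<noteq> y" "F \<noteq> ground M" for F x y
    using r2[OF that(1-4)] r3[OF that(1)] that(5) by fastforce
  have e0: "flat_rank M {} = 0"
    using flat_rank_leI[OF fin, of "{}" 0] by (auto simp: subset.chain_def)
  obtain C where C: "subset.chain {K \<in> flats M. K \<subset> ground M} C" "card C = 3"
    using flat_rank_chainE[OF fin, of "ground M"] rk by metis
  \<comment> \<open>Otherwise all proper flats would be empty or singletons. Distinct singletons are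
    incomparable, so a chain of them would have at most two members instead of three.\<close>
  have "\<exists>L. L \<in> flats M \<and> L \<subset> ground M \<and> (\<exists>x\<in>L. \<exists>y\<in>L. x \<noteq> y)"
  proof (rule ccontr)
    assume *: "\<not> ?thesis"
    have small: "K = {} \<or> (\<exists>x. K = {x})" if "K \<in> C" for K
    proof -
      have "K \<in> flats M" "K \<subset> ground M"
        using C(1) that by (auto simp: subset.chain_def)
      then show ?thesis using * by blast
    qed
    have "C - {{}} \<subseteq> {K}" if "K \<in> C - {{}}" for K
      using small C(1) that unfolding subset.chain_def by blast
    then have "card (C - {{}}) \<le> 1"
      by (metis card.empty card_mono card_1_singleton_iff finite.intros One_nat_def equals0I le_numeral_extra(4) zero_le)
    moreover have "card C \<le> Suc (card (C - {{}}))"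
      by (metis card_Diff1_le card_Suc_Diff1 card.infinite card_Diff_singleton_if diff_Suc_1 le_SucI le_refl C(2) zero_neq_numeral)
    ultimately show False using C(2) by simp
  qed
  then obtain L c d where L: "L \<in> flats M" "L \<subset> ground M" "c \<in> L" "d \<in> L" "c \<noteq> d"
    by blast
  \<comment> \<open>A flat strictly between \<open>{z}\<close> and the ground set prevents the
    ground set from covering \<open>{z}\<close>. Thus \<open>L\<close> makes the cover of
    \<open>{c}\<close> through \<open>x\<close> proper; this gives a proper flat \<open>K\<close>
    above \<open>{x}\<close>, and \<open>K\<close> makes the cover of \<open>{x}\<close> through
    \<open>y\<close> proper.\<close>
  have line: "\<exists>F\<in>flats M. F \<noteq> ground M \<and> x \<in> F \<and> y \<in> F" if xy: "x \<in> ground M" "y \<in> ground M" "x \<noteq> y" for x y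
  proof -
    have no: "\<not> flat_covers M {z} (ground M)" if "K \<in> flats M" "K \<subset> ground M" "{z} \<subset> K" for z K
      using that by (auto simp: flat_covers_def)
    have "\<exists>K. K \<in> flats M \<and> K \<subset> ground M \<and> {x} \<subset> K"
    proof (cases "x \<in> L")
      case True
      then show ?thesis using L by blast
    next
      case False
      obtain G where G: "flat_covers M {c} G" "x \<in> G"
        using cover[OF sing, of c x] L False xy by blast
      moreover have "G \<noteq> ground M"
        using no[OF L(1,2), of c] G L by blast
      moreover have "G \<in> flats M" "c \<in> G"
        using G(1) by (auto simp: flat_covers_def)
      moreover have "x \<noteq> c"
        using L(3) False by auto
      ultimately show ?thesis
        using sub[of G] by (intro exI[of _ G]) auto
    qed
    then obtain K where K: "K \<in> flats M" "K \<subset> ground M" "{x} \<subset> K" by blast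
    obtain G where G: "flat_covers M {x} G" "y \<in> G"
      using cover[OF sing, of x y] xy by blast
    moreover have "G \<noteq> ground M"
      using no[OF K] G(1) by auto
    moreover have "G \<in> flats M" "x \<in> G"
      using G(1) by (auto simp: flat_covers_def)
    ultimately show ?thesis
      by blast
  qed
  show "linear_space (ground M) (rank_flats M 2)"
  proof
    show "finite (ground M)" by fact
  next
    fix F assume "F \<in> rank_flats M 2"
    then show "F \<subset> ground M"
      using sub[of F] rk by (auto simp: rank_flats_def)
  next
    fix x y assume "x \<in> ground M" "y \<in> ground M" "x \<noteq> y"
    then show "\<exists>F\<in>rank_flats M 2. x \<in> F \<and> y \<in> F"
      using line[of x y] rs by (auto simp: rank_flats_def)
  next
    fix F G x y
    assume F: "F \<in> rank_flats M 2" and G: "G \<in> rank_flats M 2"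
      and xy: "x \<in> F" "y \<in> F" "x \<in> G" "y \<in> G" "x \<noteq> y"
    have "flat_rank M (F \<inter> G) \<ge> 2" and FG: "F \<inter> G \<in> flats M"
      using r2[of "F \<inter> G" x y] int[of F G] F G xy by (auto simp: rank_flats_def)
    then show "F = G"
      using mono[OF FG, of F] mono[OF FG, of G] F G by (force simp: rank_flats_def)
  next
    fix F assume F: "F \<in> rank_flats M 2"
    have "F \<noteq> {}"
      using F e0 by (auto simp: rank_flats_def)
    then obtain x where x: "x \<in> F" by auto
    have "F \<noteq> {x}"
    proof
      assume "F = {x}"
      have "flat_rank M F \<le> 1"
      proof (rule flat_rank_leI[OF fin])
        fix C assume "subset.chain {K \<in> flats M. K \<subset> F} C"
        then have "C \<subseteq> {{}}"
          using \<open>F = {x}\<close> by (auto simp: subset.chain_def)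
        then show "card C \<le> 1"
          using card_mono[of "{{}}" C] by simp
      qed
      then show False using F by (simp add: rank_flats_def)
    qed
    then show "\<exists>x\<in>F. \<exists>y\<in>F. x \<noteq> y" using x by blast
  next
    show "\<exists>x\<in>ground M. \<exists>y\<in>ground M. x \<noteq> y" using L by blast
  qed
  show "rank_flats M 0 = {{}}"
  proof (intro equalityI subsetI)
    fix F assume "F \<in> rank_flats M 0"
    then show "F \<in> {{}}" using r1[of F] by (force simp: rank_flats_def)
  qed (use e0 empty in \<open>simp add: rank_flats_def\<close>)
  have rank_sing: "flat_rank M {x} = 1" if x: "x \<in> ground M" for x
  proof -
    obtain y where y: "y \<in> ground M" "y \<noteq> x" using L by blast
    obtain F where F: "F \<in> flats M" "F \<noteq> ground M" "x \<in> F" "y \<in> F"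
      using line[OF x y(1)] y(2) by metis
    have "flat_rank M {x} < flat_rank M F"
      using mono[OF sing[OF x], of F] F y by blast
    then show ?thesis using rs[OF F(1,3,4)] y F r1[of "{x}"] by simp
  qed
  show "rank_flats M 1 = (\<lambda>e. {e}) ` ground M"
  proof (intro equalityI subsetI)
    fix F assume F: "F \<in> rank_flats M 1"
    then have "F \<noteq> {}" using e0 by (auto simp: rank_flats_def)
    then obtain x where x: "x \<in> F" by auto
    then have "F = {x}" using r2[of F x] F by (force simp: rank_flats_def)
    then show "F \<in> (\<lambda>e. {e}) ` ground M" using sub[of F] F by (auto simp: rank_flats_def)
  next
    fix F assume "F \<in> (\<lambda>e. {e}) ` ground M"
    then obtain x where "x \<in> ground M" "F = {x}" by auto
    then show "F \<in> rank_flats M 1" using rank_sing sing by (simp add: rank_flats_def)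
  qed
  show "rank_flats M 3 = {ground M}"
  proof (intro equalityI subsetI)
    fix F assume "F \<in> rank_flats M 3"
    then show "F \<in> {ground M}" using r3[of F] by (simp add: rank_flats_def)
  qed (use top rk in \<open>simp add: rank_flats_def\<close>)
  show "k \<le> 3" if ne: "rank_flats M k \<noteq> {}" for k
  proof -
    obtain F where "F \<in> flats M" "flat_rank M F = k"
      using ne by (auto simp: rank_flats_def)
    then show ?thesis using r3[of F] rk by fastforce
  qed
qed


section \<open>The flats cut out by the minima\<close>

text \<open>The combinatorial shadow of a tropical linear series: \<open>P \<phi>\<close> stands for
  the points of the matroid at which \<open>\<phi>\<close> is minimal. The implications in
  \<open>avoid_line_point\<close> and \<open>avoid_points\<close> reflect that a minimal point in
  the support of D + div \<phi> has no exceptional line.\<close>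

locale minima_system = linear_space E H
  for E :: "'a set" and H :: "'a set set" +
  fixes \<Sigma> :: "'b set" and P :: "'b \<Rightarrow> 'a set" and X :: "'b \<Rightarrow> 'a set set"
  assumes X_sub: "X \<phi> \<subseteq> H"
    and line_in_min: "\<phi> \<in> \<Sigma> \<Longrightarrow> F \<in> H \<Longrightarrow> F \<notin> X \<phi> \<Longrightarrow> e \<in> F \<Longrightarrow> e \<in> P \<phi>"
    and at_most_one: "\<phi> \<in> \<Sigma> \<Longrightarrow> e \<in> P \<phi> \<Longrightarrow> F \<in> X \<phi> \<Longrightarrow> G \<in> X \<phi> \<Longrightarrow> e \<in> F \<Longrightarrow> e \<in> G \<Longrightarrow> F = G"
    and P_ne: "\<phi> \<in> \<Sigma> \<Longrightarrow> \<exists>e\<in>E. e \<in> P \<phi>"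
    and X_Int: "\<phi> \<in> \<Sigma> \<Longrightarrow> \<psi> \<in> \<Sigma> \<Longrightarrow> \<exists>\<rho>\<in>\<Sigma>. X \<rho> = X \<phi> \<inter> X \<psi>"
    \<comment> \<open>the three instances of the Baker--Norine property for a divisor of degree 2 supported at vertices\<close>
    and avoid_lines: "F \<in> H \<Longrightarrow> G \<in> H \<Longrightarrow> \<exists>\<phi>\<in>\<Sigma>. F \<in> X \<phi> \<and> G \<in> X \<phi>"
    and avoid_line_point: "F \<in> H \<Longrightarrow> g \<in> E \<Longrightarrow>
      \<exists>\<phi>\<in>\<Sigma>. F \<in> X \<phi> \<and> (g \<in> P \<phi> \<longrightarrow> (\<forall>G\<in>X \<phi>. g \<notin> G))"
    and avoid_points: "e \<in> E \<Longrightarrow> f \<in> E \<Longrightarrow>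
      \<exists>\<phi>\<in>\<Sigma>. (e \<in> P \<phi> \<longrightarrow> (\<forall>G\<in>X \<phi>. e \<notin> G)) \<and> (f \<in> P \<phi> \<longrightarrow> (\<forall>G\<in>X \<phi>. f \<notin> G))"
    and chain_card: "subset.chain (X ` \<Sigma>) C \<Longrightarrow> card C \<le> 3"
begin

section \<open>Flats forced by the degree 2 conditions\<close>

lemma X_psub:
  assumes "\<phi> \<in> \<Sigma>"
  shows "X \<phi> \<noteq> H"
  \<comment> \<open>Two lines through a minimal point cannot both lie in \<open>X \<phi>\<close>.
    Hence the full set of lines is never attained and has to be adjoined as the top flat.\<close>
  using P_ne[OF assms] two_lines_through at_most_one[OF assms] by metis

lemma Inter_flats:
  assumes "A \<subseteq> X ` \<Sigma>" "A \<noteq> {}"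
  shows "\<Inter>A \<in> X ` \<Sigma>"
proof -
  have "finite A"
    by (rule finite_subset[of _ "Pow H"]) (use assms(1) X_sub finite_lines in auto)
  then show ?thesis
    using assms(2,1)
  proof (induction rule: finite_ne_induct)
    case (insert x F)
    then show ?case using X_Int by (metis (no_types, lifting) Inter_insert image_iff insert_subset)
  qed auto
qed

text \<open>Two points \<open>e\<close>, \<open>f\<close> of \<open>F\<close> are prescribed. If
  either of them is minimal, then \<open>F\<close> is excluded, so it remains to carry minimality
  from some point to \<open>e\<close> or \<open>f\<close>.\<close>

lemma not_flat_through_line:
  assumes "F \<in> H"
  shows "\<exists>\<phi>\<in>\<Sigma>. F \<notin> X \<phi>"
proof -
  obtain e f where ef: "e \<in> F" "f \<in> F" "e \<noteq> f"
    using line_two_points assms by metis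
  have E: "e \<in> E" "f \<in> E" using line_psubset[OF assms] ef by auto
  obtain \<phi> where \<phi>: "\<phi> \<in> \<Sigma>" and a: "e \<in> P \<phi> \<Longrightarrow> F \<notin> X \<phi>" "f \<in> P \<phi> \<Longrightarrow> F \<notin> X \<phi>"
    using avoid_points[OF E] ef by metis
  \<comment> \<open>The lines from \<open>g\<close> to \<open>e\<close> and to \<open>f\<close> are
    distinct, so one of them is not in \<open>X \<phi>\<close>, and its point \<open>e\<close> or
    \<open>f\<close> is minimal.\<close>
  have off: "F \<notin> X \<phi>" if g: "g \<in> P \<phi>" "g \<in> E" "g \<notin> F" for g
  proof -
    obtain A B where A: "A \<in> H" "g \<in> A" "e \<in> A" and B: "B \<in> H" "g \<in> B" "f \<in> B"
      using line_exists[OF g(2)] E ef g(3) by metis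
    have "A \<noteq> B" using line_unique[OF assms A(1)] ef A B g(3) by metis
    then show ?thesis using at_most_one[OF \<phi> g(1)] A B a line_in_min[OF \<phi>] by metis
  qed
  obtain g where g: "g \<in> E" "g \<in> P \<phi>" using P_ne[OF \<phi>] by auto
  have "F \<notin> X \<phi>"
  proof (cases "g \<in> F")
    case True
    \<comment> \<open>If \<open>F\<close> were in \<open>X \<phi>\<close>, the line from
      \<open>g\<close> to \<open>h\<close> could not be; then \<open>h\<close> would be a minimal
      point off \<open>F\<close>, and \<open>off\<close> would exclude \<open>F\<close> after
      all.\<close>
    obtain h where h: "h \<in> E" "h \<notin> F" using line_psubset[OF assms] by auto
    then obtain A where "A \<in> H" "g \<in> A" "h \<in> A" using line_exists[OF g(1)] True by metis
    then show ?thesis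
      using at_most_one[OF \<phi> g(2)] True line_in_min[OF \<phi>] off h by metis
  qed (use off g in auto)
  then show ?thesis using \<phi> by auto
qed

text \<open>Every line is missed by some member of the family, so the intersection of the whole
  family, again a member, is empty.\<close>

lemma empty_flat: "{} \<in> X ` \<Sigma>"
proof -
  have "H \<noteq> {}" using two_points line_exists by blast
  then obtain F where "F \<in> H" by auto
  then have "X ` \<Sigma> \<noteq> {}" using not_flat_through_line by blast
  then have "\<Inter>(X ` \<Sigma>) \<in> X ` \<Sigma>" by (intro Inter_flats) auto
  moreover have "\<Inter>(X ` \<Sigma>) = {}"
    using not_flat_through_line X_sub \<open>X ` \<Sigma> \<noteq> {}\<close> by blast
  ultimately show ?thesis by simp
qed

text \<open>\<open>F\<close> is prescribed together with a point \<open>g\<close> of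
  \<open>G\<close> off \<open>F\<close>. The condition at \<open>g\<close> excludes \<open>G\<close>
  as soon as \<open>g\<close> is minimal, and that is the real content.\<close>

lemma separate_lines:
  assumes "F \<in> H" "G \<in> H" "F \<noteq> G"
  shows "\<exists>\<phi>\<in>\<Sigma>. F \<in> X \<phi> \<and> G \<notin> X \<phi>"
proof -
  obtain g where g: "g \<in> G" "g \<notin> F" using line_point_off[of G F] assms by metis
  then have gE: "g \<in> E" using line_psubset assms(2) by blast
  obtain \<phi> where \<phi>: "\<phi> \<in> \<Sigma>" "F \<in> X \<phi>" "g \<in> P \<phi> \<Longrightarrow> G \<notin> X \<phi>"
    using avoid_line_point[OF assms(1) gE] g by metis
  \<comment> \<open>From a minimal point \<open>e\<close>, the line \<open>A\<close> to
    \<open>g\<close> would lie in \<open>X \<phi>\<close>. A point \<open>f\<close> of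
    \<open>F\<close> off \<open>A\<close> is reached along a different line \<open>B\<close>, so
    \<open>f\<close> is minimal. Its one exceptional line is \<open>F\<close>, so the line
    \<open>K\<close> from \<open>f\<close> to \<open>g\<close> makes \<open>g\<close>
    minimal.\<close>
  have "g \<in> P \<phi>"
  proof (rule ccontr)
    assume ng: "g \<notin> P \<phi>"
    obtain e where e: "e \<in> E" "e \<in> P \<phi>" using P_ne[OF \<phi>(1)] by auto
    obtain A where A: "A \<in> H" "e \<in> A" "g \<in> A" using line_exists[OF e(1) gE] e ng by metis
    have AX: "A \<in> X \<phi>" using line_in_min[OF \<phi>(1)] A ng by metis
    have "F \<noteq> A" using A g by auto
    then obtain f where f: "f \<in> F" "f \<notin> A" using line_point_off assms(1) A(1) by metis
    have fE: "f \<in> E" using f line_psubset assms(1) by blast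
    have "f \<noteq> e" using f A by auto
    obtain B where B: "B \<in> H" "e \<in> B" "f \<in> B" using line_exists[OF e(1) fE] \<open>f \<noteq> e\<close> by metis
    have "B \<notin> X \<phi>" using at_most_one[OF \<phi>(1) e(2) AX] A B f by metis
    then have fP: "f \<in> P \<phi>" using line_in_min[OF \<phi>(1)] B by metis
    have "f \<noteq> g" using f g by auto
    then obtain K where K: "K \<in> H" "f \<in> K" "g \<in> K" using line_exists[OF fE gE] by metis
    then have "K \<notin> X \<phi>" using at_most_one[OF \<phi>(1) fP \<phi>(2)] f g by metis
    then show False using line_in_min[OF \<phi>(1)] K ng by metis
  qed
  then show ?thesis using \<phi> by auto
qed

text \<open>Among all members containing \<open>F\<close>, every other line is missed by one of
  them, so their intersection is \<open>{F}\<close>.\<close>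

lemma singleton_flat:
  assumes "F \<in> H"
  shows "{F} \<in> X ` \<Sigma>"
proof -
  let ?A = "{Y \<in> X ` \<Sigma>. F \<in> Y}"
  have ne: "?A \<noteq> {}" using avoid_lines[OF assms assms] by auto
  then have "\<Inter>?A \<in> X ` \<Sigma>" by (intro Inter_flats) auto
  moreover have "\<Inter>?A = {F}"
  proof (intro equalityI subsetI)
    fix G assume G: "G \<in> \<Inter>?A"
    then have "G \<in> H" using ne X_sub by blast
    then show "G \<in> {F}" using separate_lines[OF assms, of G] G by blast
  qed auto
  ultimately show ?thesis by simp
qed

text \<open>Two lines of \<open>X \<phi>\<close> through \<open>e\<close> prevent \<open>e\<close>
  from being minimal, and then no line through \<open>e\<close> can lie in the minimum
  locus.\<close>

lemma flat_two_lines_through: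
  assumes \<phi>: "\<phi> \<in> \<Sigma>" and F: "F \<in> X \<phi>" "e \<in> F" and G: "G \<in> X \<phi>" "e \<in> G" and "F \<noteq> G"
  shows "X \<phi> = {K \<in> H. e \<in> K}"
proof -
  have e: "e \<notin> P \<phi>" using at_most_one[OF \<phi>] assms by metis
  have eE: "e \<in> E" using line_psubset X_sub F by blast
  obtain d where d: "d \<in> E" "d \<in> P \<phi>" using P_ne[OF \<phi>] by auto
  obtain A where A: "A \<in> H" "e \<in> A" "d \<in> A" using line_exists[OF eE d(1)] d(2) e by metis
  have AX: "A \<in> X \<phi>" using line_in_min[OF \<phi>] A e by metis
  \<comment> \<open>The minimal point \<open>d\<close> already spends its exception on the line
    \<open>A\<close> to \<open>e\<close>. So a point \<open>k\<close> of \<open>K\<close> off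
    \<open>A\<close> is minimal, and it spends its exception on the line \<open>J\<close> to
    \<open>e\<close>, leaving none for \<open>K\<close>.\<close>
  have "K \<notin> X \<phi>" if K: "K \<in> H" "e \<notin> K" for K
  proof -
    have "K \<noteq> A" using K A by auto
    then obtain k where k: "k \<in> K" "k \<notin> A" using line_point_off K(1) A(1) by metis
    have kE: "k \<in> E" using k K line_psubset by blast
    have "k \<noteq> d" using k A by auto
    then obtain B where B: "B \<in> H" "d \<in> B" "k \<in> B" using line_exists[OF d(1) kE] by metis
    have "B \<notin> X \<phi>" using at_most_one[OF \<phi> d(2) AX] A B k by metis
    then have kP: "k \<in> P \<phi>" using line_in_min[OF \<phi>] B by metis
    have "k \<noteq> e" using k A by auto
    then obtain J where J: "J \<in> H" "k \<in> J" "e \<in> J" using line_exists[OF kE eE] by metis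
    then have "J \<in> X \<phi>" using line_in_min[OF \<phi>] e by metis
    then show ?thesis using at_most_one[OF \<phi> kP] J k K by metis
  qed
  moreover have "K \<in> X \<phi>" if "K \<in> H" "e \<in> K" for K
    using line_in_min[OF \<phi> that(1) _ that(2)] e by auto
  ultimately show ?thesis using X_sub by blast
qed

lemma pencil_flat:
  assumes "e \<in> E"
  shows "{K \<in> H. e \<in> K} \<in> X ` \<Sigma>"
proof -
  obtain F G where FG: "F \<in> H" "G \<in> H" "F \<noteq> G" "e \<in> F" "e \<in> G"
    using two_lines_through[OF assms] by metis
  then obtain \<phi> where \<phi>: "\<phi> \<in> \<Sigma>" "F \<in> X \<phi>" "G \<in> X \<phi>" using avoid_lines by metis
  have eq: "X \<phi> = {K \<in> H. e \<in> K}"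
    by (rule flat_two_lines_through[OF \<phi>(1,2) FG(4) \<phi>(3) FG(5,3)])
  show ?thesis
    using imageI[OF \<phi>(1), of X] unfolding eq .
qed

text \<open>With \<open>{}\<close> at the bottom these sets would form a chain of four attained
  sets. The top flat \<open>H\<close> is not attained, so the flats have height at most
  three.\<close>

lemma no_four_chain:
  assumes "A \<in> X ` \<Sigma>" "B \<in> X ` \<Sigma>" "C \<in> X ` \<Sigma>" "A \<noteq> {}" "A \<subset> B" "B \<subset> C"
  shows False
proof -
  have "subset.chain (X ` \<Sigma>) {{}, A, B, C}"
    unfolding subset.chain_def using assms empty_flat by blast
  moreover have "{} \<noteq> A" "{} \<noteq> B" "{} \<noteq> C" "A \<noteq> B" "A \<noteq> C" "B \<noteq> C"
    using assms by auto
  ultimately show False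
    using chain_card[of "{{}, A, B, C}"] by simp
qed

section \<open>The matroid on the set of lines and its ranks\<close>

abbreviation W :: "'a set matroid" where
  "W \<equiv> \<lparr>ground = H, flats = insert H (X ` \<Sigma>)\<rparr>"

lemma finite_flats: "finite (flats W)"
  by (rule finite_subset[of _ "Pow H"]) (use X_sub finite_lines in auto)

lemma exists_cover:
  assumes F: "F \<in> X ` \<Sigma>" and e: "e \<in> H - F"
  shows "\<exists>G. flat_covers W F G \<and> e \<in> G"
proof -
  have FH: "F \<subset> H" using F X_sub X_psub by blast
  \<comment> \<open>The cover is respectively the singleton \<open>{e}\<close>, any attained set
    containing both \<open>f\<close> and \<open>e\<close>, and the top flat \<open>H\<close>. In the
    last two cases \<open>no_four_chain\<close> excludes intermediate flats.\<close>
  consider "F = {}" | f where "F = {f}" | f g where "f \<in> F" "g \<in> F" "f \<noteq> g"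
    by blast
  then show ?thesis
  proof cases
    case 1
    have "flat_covers W F {e}"
      using 1 e F singleton_flat unfolding flat_covers_def by auto
    then show ?thesis by auto
  next
    case 2
    then obtain \<phi> where \<phi>: "\<phi> \<in> \<Sigma>" "f \<in> X \<phi>" "e \<in> X \<phi>"
      using avoid_lines[of f e] FH e by auto
    have "F \<subset> X \<phi>" using 2 e \<phi> by blast
    moreover have "\<not> (\<exists>K\<in>flats W. F \<subset> K \<and> K \<subset> X \<phi>)"
      using no_four_chain[OF F] 2 \<phi>(1) X_sub[of \<phi>] by auto
    ultimately have "flat_covers W F (X \<phi>)"
      using F \<phi>(1) unfolding flat_covers_def by auto
    then show ?thesis using \<phi> by auto
  next
    case 3
    have "{f} \<in> X ` \<Sigma>" using singleton_flat 3 FH by blast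
    moreover have "{f} \<subset> F" using 3 by blast
    ultimately have "\<not> (\<exists>K\<in>flats W. F \<subset> K \<and> K \<subset> H)"
      using no_four_chain[of "{f}" F] F by auto
    then have "flat_covers W F H"
      using F FH unfolding flat_covers_def by auto
    then show ?thesis using e by auto
  qed
qed

lemma flats_Int:
  assumes "F \<in> flats W" "G \<in> flats W"
  shows "F \<inter> G \<in> flats W"
proof (cases "F = H \<or> G = H")
  case True
  then have "F \<inter> G = F \<or> F \<inter> G = G" using assms X_sub by auto
  then show ?thesis using assms by metis
next
  case False
  then obtain \<phi> \<psi> where "\<phi> \<in> \<Sigma>" "\<psi> \<in> \<Sigma>" "F = X \<phi>" "G = X \<psi>" using assms by auto
  then obtain \<rho> where "\<rho> \<in> \<Sigma>" "X \<rho> = F \<inter> G" using X_Int by metis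
  then have "F \<inter> G \<in> X ` \<Sigma>" by (metis imageI)
  then show ?thesis by simp
qed

lemma is_matroid_W: "is_matroid W"
  unfolding is_matroid_def
proof (intro conjI ballI)
  fix F e assume F: "F \<in> flats W" and e: "e \<in> ground W - F"
  then have "F \<in> X ` \<Sigma>" by auto
  then obtain G where G: "flat_covers W F G" "e \<in> G" using exists_cover e by auto
  \<comment> \<open>Two covers containing \<open>e\<close> intersect in a flat that is strictly
    above \<open>F\<close> because of \<open>e\<close>, so each equals the intersection.\<close>
  have "G' = G" if G': "flat_covers W F G'" "e \<in> G'" for G'
  proof -
    have "G \<inter> G' \<in> flats W" using G G' flats_Int by (simp add: flat_covers_def)
    moreover have "F \<subset> G \<inter> G'" using G G' e by (auto simp: flat_covers_def)
    ultimately show ?thesis using G(1) G'(1) unfolding flat_covers_def by blast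
  qed
  then show "\<exists>!G. flat_covers W F G \<and> e \<in> G" using G by blast
next
  fix F G assume "F \<in> flats W" "G \<in> flats W"
  then show "F \<inter> G \<in> flats W" by (rule flats_Int)
qed (use X_sub finite_lines in auto)

text \<open>The strict chain from \<open>{}\<close> through a single line and a pencil to
  \<open>H\<close> has three steps and \<open>H\<close> has rank at most 3, so all the ranks are
  pinned.\<close>

lemma ranks_W:
  assumes e: "e \<in> E" and F: "F \<in> H"
  shows "matroid_rank W = 3" "{K \<in> H. e \<in> K} \<in> corank_flats W 1" "{F} \<in> corank_flats W 2"
    "H \<in> corank_flats W 0" "{} \<in> corank_flats W 3"
proof -
  note mono = flat_rank_strict_mono[OF finite_flats]
  have le: "flat_rank W H \<le> 3"
  proof (rule flat_rank_leI[OF finite_flats])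
    fix C assume "subset.chain {K \<in> flats W. K \<subset> H} C"
    then have "subset.chain (X ` \<Sigma>) C" by (auto simp: subset.chain_def)
    then show "card C \<le> 3" by (rule chain_card)
  qed
  have pencil: "{K \<in> H. d \<in> K} \<in> X ` \<Sigma>" "{K \<in> H. d \<in> K} \<subset> H" if "d \<in> E" for d
  proof -
    show p: "{K \<in> H. d \<in> K} \<in> X ` \<Sigma>" using that by (rule pencil_flat)
    then have "{K \<in> H. d \<in> K} \<noteq> H" using X_psub by (metis imageE)
    then show "{K \<in> H. d \<in> K} \<subset> H" by blast
  qed
  have s: "flat_rank W {} < flat_rank W {F}" if "F \<in> H" for F
    using mono[of "{}" "{F}"] empty_flat that by auto
  have p: "flat_rank W {F} < flat_rank W {K \<in> H. d \<in> K}" if "F \<in> H" "d \<in> F" for F d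
  proof -
    have d: "d \<in> E" using that line_psubset by blast
    then obtain A B where "A \<in> H" "B \<in> H" "A \<noteq> B" "d \<in> A" "d \<in> B" by (rule two_lines_through)
    then have "A \<in> {K \<in> H. d \<in> K}" "B \<in> {K \<in> H. d \<in> K}" "A \<noteq> B"
      by simp_all
    then have "{K \<in> H. d \<in> K} \<noteq> {F}"
      by (metis singletonD)
    moreover have "{F} \<subseteq> {K \<in> H. d \<in> K}"
      using that by simp
    ultimately have "{F} \<subset> {K \<in> H. d \<in> K}"
      by (metis psubsetI)
    then show ?thesis
      by (rule mono[rotated]) (use singleton_flat[OF that(1)] in simp)
  qed
  have t: "flat_rank W {K \<in> H. d \<in> K} < flat_rank W H" if "d \<in> E" for d
    by (rule mono[OF _ pencil(2)[OF that]]) (use pencil(1)[OF that] in simp)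
  obtain f where f: "f \<in> F" using line_two_points F by blast
  then have fE: "f \<in> E" using line_psubset F by blast
  obtain A where A: "A \<in> H" "e \<in> A" using two_lines_through[OF e] by metis
  \<comment> \<open>Two chains are used, one through the given line \<open>F\<close> and one through
    the pencil of the given point \<open>e\<close>, since \<open>e\<close> need not lie on
    \<open>F\<close>.\<close>
  note ineqs = le s[OF F] p[OF F f] t[OF fE] s[OF A(1)] p[OF A] t[OF e]
  have rk: "flat_rank W H = 3" "flat_rank W {K \<in> H. e \<in> K} = 2" "flat_rank W {F} = 1" "flat_rank W {} = 0"
    using ineqs by linarith+
  show r: "matroid_rank W = 3"
    using rk(1) by (simp add: matroid_rank_def)
  show "{K \<in> H. e \<in> K} \<in> corank_flats W 1"
    unfolding corank_flats_def r using rk(2) pencil_flat[OF e] by simp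
  show "{F} \<in> corank_flats W 2"
    unfolding corank_flats_def r using rk(3) singleton_flat[OF F] by simp
  show "H \<in> corank_flats W 0"
    unfolding corank_flats_def r using rk(1) by simp
  show "{} \<in> corank_flats W 3"
    unfolding corank_flats_def r using rk(4) empty_flat by simp
qed

end

text \<open>Over a flat of rank 0, 1, 2 or 3 lie, respectively, all lines, a pencil, the line
  itself, or no line. These are the flats whose coranks were computed in
  \<open>ranks_W\<close>.\<close>

lemma minima_system_adjoint:
  assumes simple: "simple_matroid M" and rank: "matroid_rank M = 3"
    and "minima_system (ground M) (rank_flats M 2) \<Sigma> P X"
  shows "is_adjoint M \<lparr>ground = rank_flats M 2, flats = insert (rank_flats M 2) (X ` \<Sigma>)\<rparr>"
proof -
  note M = rank3_linear_space[OF simple rank]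
  interpret minima_system "ground M" "rank_flats M 2" \<Sigma> P X by fact
  have H: "corank_flats M 1 = rank_flats M 2"
    using rank by (simp add: corank_flats_def rank_flats_def)
  obtain e L where e: "e \<in> ground M" and L: "L \<in> rank_flats M 2"
    using two_points line_exists by metis
  show ?thesis
    unfolding is_adjoint_def H
  proof (intro conjI allI ballI)
    fix k F assume F': "F \<in> rank_flats M k"
    then have "k \<le> 3" using M(5)[of k] by auto
    then consider "k = 0" | "k = 1" | "k = 2" | "k = 3" by linarith
    then show "{G \<in> rank_flats M 2. F \<subseteq> G} \<in> corank_flats W k"
    proof cases
      case 1
      then have "F = {}" using F' M(2) by simp
      then have eq: "{G \<in> rank_flats M 2. F \<subseteq> G} = rank_flats M 2" by blast
      show ?thesis unfolding eq 1 by (rule ranks_W(4)[OF e L])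
    next
      case 2
      then obtain x where x: "F = {x}" "x \<in> ground M" using F' M(3) by auto
      then have eq: "{G \<in> rank_flats M 2. F \<subseteq> G} = {G \<in> rank_flats M 2. x \<in> G}" by blast
      show ?thesis unfolding eq 2 by (rule ranks_W(2)[OF x(2) L])
    next
      case 3
      have "G = F" if "G \<in> rank_flats M 2" "F \<subseteq> G" for G
        using line_two_points line_unique F' 3 that by (metis subsetD)
      then have eq: "{G \<in> rank_flats M 2. F \<subseteq> G} = {F}" using F' 3 by blast
      show ?thesis unfolding eq 3 using F' unfolding 3 by (rule ranks_W(3)[OF e])
    next
      case 4
      then have "F = ground M" using F' M(4) by simp
      then have eq: "{G \<in> rank_flats M 2. F \<subseteq> G} = {}" using line_psubset by blast
      show ?thesis unfolding eq 4 by (rule ranks_W(5)[OF e L])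
    qed
  next
    show "is_matroid W" by (rule is_matroid_W)
    show "matroid_rank W = matroid_rank M" unfolding rank by (rule ranks_W(1)[OF e L])
  qed simp
qed

section \<open>Levi graphs\<close>

lemma min_locus_eq:
  assumes "\<And>p. p \<in> points \<Gamma> \<Longrightarrow> c \<le> f p" "q \<in> points \<Gamma>" "f q = c"
  shows "min_locus \<Gamma> f = {p \<in> points \<Gamma>. f p = c}"
  unfolding min_locus_def using assms by (auto intro: antisym)

locale levi = linear_space "ground M" "rank_flats M 2"
  for M :: "'a matroid" +
  fixes l :: "'a \<times> 'a set \<Rightarrow> real"
  assumes len_pos: "F \<in> rank_flats M 2 \<Longrightarrow> e \<in> F \<Longrightarrow> l (e, F) > 0"
begin

section \<open>Points, edges and divisors of the Levi graph\<close>

abbreviation "H \<equiv> rank_flats M 2"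
abbreviation "\<Gamma> \<equiv> levi_graph M l"
abbreviation "D \<equiv> cartwright_divisor M"
abbreviation pvert :: "'a \<Rightarrow> ('a + 'a set, 'a \<times> 'a set) point" where "pvert e \<equiv> Vertex (Inl e)"
abbreviation lvert :: "'a set \<Rightarrow> ('a + 'a set, 'a \<times> 'a set) point" where "lvert F \<equiv> Vertex (Inr F)"

lemma in_line: "F \<in> H \<Longrightarrow> e \<in> F \<Longrightarrow> e \<in> ground M"
  using line_psubset by blast

lemma edge_point_simps:
  assumes "F \<in> H" "e \<in> F"
  shows "edge_point \<Gamma> (e, F) 0 = pvert e"
    and "edge_point \<Gamma> (e, F) (l (e, F)) = lvert F"
    and "0 < t \<Longrightarrow> t < l (e, F) \<Longrightarrow> edge_point \<Gamma> (e, F) t = Interior (e, F) t"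
  using len_pos[OF assms] by (auto simp: edge_point_def levi_graph_def)

lemma edge_point_in_points:
  assumes "F \<in> H" "e \<in> F"
  shows "edge_point \<Gamma> (e, F) t \<in> points \<Gamma>"
  using assms in_line[OF assms]
  by (auto simp: edge_point_def levi_graph_def points_def edge_interior_def)

lemma pt_in_points: "e \<in> ground M \<Longrightarrow> pvert e \<in> points \<Gamma>"
  and ln_in_points: "F \<in> H \<Longrightarrow> lvert F \<in> points \<Gamma>"
  by (auto simp: levi_graph_def points_def)

text \<open>There are no isolated vertices: each point lies on a line and each line contains a
  point. Statements about the graph thus reduce to its closed edges.\<close>

lemma pointE:
  assumes "p \<in> points \<Gamma>"
  obtains e F t where "F \<in> H" "e \<in> F" "t \<in> {0..l (e, F)}" "p = edge_point \<Gamma> (e, F) t"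
proof -
  consider e where "e \<in> ground M" "p = pvert e" | F where "F \<in> H" "p = lvert F"
    | e F t where "F \<in> H" "e \<in> F" "0 < t" "t < l (e, F)" "p = Interior (e, F) t"
    using assms by (auto simp: levi_graph_def points_def edge_interior_def)
  then show ?thesis
  proof cases
    case 1
    obtain F where F: "F \<in> H" "e \<in> F" using two_lines_through[OF 1(1)] by metis
    then show ?thesis using that[OF F, of 0] edge_point_simps(1)[OF F] len_pos[OF F] 1 by simp
  next
    case 2
    obtain e where "e \<in> F" using line_two_points 2 by metis
    note F = 2(1) this
    then show ?thesis using that[OF F, of "l (e, F)"] edge_point_simps(2)[OF F] len_pos[OF F] 2 by simp
  next
    case 3
    then show ?thesis using that[OF 3(1,2), of t] edge_point_simps(3)[OF 3(1-4)] by simp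
  qed
qed

lemma component_subset_iff:
  assumes "F \<in> H"
  shows "levi_component M l F \<subseteq> A \<longleftrightarrow>
    lvert F \<in> A \<and> (\<forall>e\<in>F. \<forall>t. 0 < t \<longrightarrow> t < l (e, F) \<longrightarrow> edge_point \<Gamma> (e, F) t \<in> A)"
proof -
  have "edge_interior \<Gamma> (e, F) = {edge_point \<Gamma> (e, F) t |t. 0 < t \<and> t < l (e, F)}" if "e \<in> F" for e
    using edge_point_simps(3)[OF assms that]
    by (force simp: edge_interior_def levi_graph_def)
  then show ?thesis unfolding levi_component_def by fastforce
qed

lemma cartwright_simps:
  "e \<in> ground M \<Longrightarrow> D (pvert e) = 1" "D (lvert F) = 0" "D (Interior k t) = 0"
  using finite_points by (auto simp: cartwright_divisor_def of_bool_def sum.delta')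

text \<open>Every edge runs from its point vertex at parameter 0 to its line vertex at parameter
  \<open>l (e, F)\<close>.\<close>

definition edge_fun :: "(('a + 'a set, 'a \<times> 'a set) point \<Rightarrow> real) \<Rightarrow> 'a \<Rightarrow> 'a set \<Rightarrow> real \<Rightarrow> real" where
  "edge_fun \<phi> e F = (\<lambda>s. \<phi> (edge_point \<Gamma> (e, F) s))"

text \<open>A point vertex is only ever a tail, so just the outgoing slopes survive. A line vertex
  is only ever a head, which leaves the incoming ones.\<close>

lemma principal_divisor_pt:
  assumes "e \<in> ground M"
  shows "principal_divisor \<Gamma> \<phi> (pvert e) = - (\<Sum>F | F \<in> H \<and> e \<in> F. slope_right (edge_fun \<phi> e F) 0)"
proof -
  have h: "{k \<in> edges \<Gamma>. head \<Gamma> k = Inl e} = {}"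
    by (auto simp: levi_graph_def)
  have t: "{k \<in> edges \<Gamma>. tail \<Gamma> k = Inl e} = Pair e ` {F \<in> H. e \<in> F}"
    by (auto simp: levi_graph_def)
  show ?thesis
    using pt_in_points[OF assms]
    by (simp add: principal_divisor_def h t sum.reindex inj_on_def edge_fun_def)
qed

lemma principal_divisor_ln:
  assumes "F \<in> H"
  shows "principal_divisor \<Gamma> \<phi> (lvert F) = (\<Sum>e\<in>F. slope_left (edge_fun \<phi> e F) (l (e, F)))"
proof -
  have h: "{k \<in> edges \<Gamma>. head \<Gamma> k = Inr F} = (\<lambda>e. (e, F)) ` F"
    using assms by (auto simp: levi_graph_def)
  have t: "{k \<in> edges \<Gamma>. tail \<Gamma> k = Inr F} = {}"
    by (auto simp: levi_graph_def)
  have "len \<Gamma> = l" by (simp add: levi_graph_def)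
  then show ?thesis
    using ln_in_points[OF assms]
    by (simp add: principal_divisor_def h t sum.reindex inj_on_def edge_fun_def)
qed

text \<open>\<open>D\<close> vanishes on the open edges, so effectivity there amounts to concavity
  along each edge.\<close>

lemma R_spaceD:
  assumes "\<phi> \<in> R_space \<Gamma> D" and F: "F \<in> H" "e \<in> F"
  shows "int_piecewise_linear (l (e, F)) (edge_fun \<phi> e F)"
    and "\<And>t. 0 < t \<Longrightarrow> t < l (e, F) \<Longrightarrow> slope_right (edge_fun \<phi> e F) t \<le> slope_left (edge_fun \<phi> e F) t"
proof -
  show "int_piecewise_linear (l (e, F)) (edge_fun \<phi> e F)"
    using assms by (auto simp: R_space_def PL_def edge_fun_def levi_graph_def)
next
  fix t assume t: "0 < t" "t < l (e, F)"
  then have "Interior (e, F) t \<in> points \<Gamma>"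
    using edge_point_in_points[OF F, of t] edge_point_simps(3)[OF F] by simp
  moreover have "0 \<le> D (Interior (e, F) t) + principal_divisor \<Gamma> \<phi> (Interior (e, F) t)"
    using assms(1) by (simp add: R_space_def effective_def)
  ultimately show "slope_right (edge_fun \<phi> e F) t \<le> slope_left (edge_fun \<phi> e F) t"
    by (simp add: cartwright_simps principal_divisor_def edge_fun_def)
qed

section \<open>The minimum locus of a function in R(D)\<close>

lemma min_locus_ne:
  assumes "\<phi> \<in> R_space \<Gamma> D"
  shows "\<exists>p. p \<in> min_locus \<Gamma> \<phi>"
proof -
  have "\<exists>t\<in>{0..l k}. \<forall>s\<in>{0..l k}. edge_fun \<phi> (fst k) (snd k) t \<le> edge_fun \<phi> (fst k) (snd k) s"
    if k: "k \<in> edges \<Gamma>" for k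
  proof -
    obtain e F where kF: "k = (e, F)" "F \<in> H" "e \<in> F"
      using k by (cases k) (auto simp: levi_graph_def)
    show ?thesis
      using R_spaceD(1)[OF assms kF(2,3)] len_pos[OF kF(2,3)]
        continuous_attains_inf[of "{0..l k}" "edge_fun \<phi> e F"]
      by (simp add: int_piecewise_linear_def kF(1))
  qed
  \<comment> \<open>Compactness is applied one edge at a time; the best of these finitely many
    minimisers is a global one.\<close>
  then obtain T where T: "\<And>k. k \<in> edges \<Gamma> \<Longrightarrow> T k \<in> {0..l k}"
    "\<And>k s. k \<in> edges \<Gamma> \<Longrightarrow> s \<in> {0..l k} \<Longrightarrow>
      edge_fun \<phi> (fst k) (snd k) (T k) \<le> edge_fun \<phi> (fst k) (snd k) s"
    by metis
  have fin: "finite (edges \<Gamma>)"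
    by (rule finite_subset[of _ "ground M \<times> H"])
      (use finite_points finite_lines in_line in \<open>auto simp: levi_graph_def\<close>)
  obtain e F where "F \<in> H" "e \<in> F" using two_points line_exists by metis
  then have ne: "edges \<Gamma> \<noteq> {}" by (auto simp: levi_graph_def)
  obtain k where k: "k \<in> edges \<Gamma>"
    "\<And>j. j \<in> edges \<Gamma> \<Longrightarrow> edge_fun \<phi> (fst k) (snd k) (T k) \<le> edge_fun \<phi> (fst j) (snd j) (T j)"
    using ex_min_if_finite[of "(\<lambda>k. edge_fun \<phi> (fst k) (snd k) (T k)) ` edges \<Gamma>"] fin ne
    by (auto simp: not_less)
  have "edge_point \<Gamma> k (T k) \<in> min_locus \<Gamma> \<phi>"
    unfolding min_locus_def
  proof (intro CollectI conjI ballI)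
    show "edge_point \<Gamma> k (T k) \<in> points \<Gamma>"
      using k(1) edge_point_in_points by (auto simp: levi_graph_def)
  next
    fix q assume "q \<in> points \<Gamma>"
    then obtain e F t where q: "F \<in> H" "e \<in> F" "t \<in> {0..l (e, F)}" "q = edge_point \<Gamma> (e, F) t"
      by (rule pointE)
    have "(e, F) \<in> edges \<Gamma>" using q by (auto simp: levi_graph_def)
    then show "\<phi> (edge_point \<Gamma> k (T k)) \<le> \<phi> q"
      using k(2)[of "(e,F)"] T(2)[of "(e,F)" t] q by (auto simp: edge_fun_def)
  qed
  then show ?thesis by auto
qed

text \<open>Away from point vertices \<open>D\<close> contributes nothing, so a minimum spreads over
  the edge. The condition \<open>0 < t\<close> keeps off the point vertex, where the coefficient 1
  of \<open>D\<close> allows one unit of outgoing slope.\<close>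

lemma min_locus_edge:
  assumes R: "\<phi> \<in> R_space \<Gamma> D" and F: "F \<in> H" "e \<in> F"
    and t: "0 < t" "t \<le> l (e, F)" "edge_point \<Gamma> (e, F) t \<in> min_locus \<Gamma> \<phi>"
    and s: "s \<in> {0..l (e, F)}"
  shows "edge_point \<Gamma> (e, F) s \<in> min_locus \<Gamma> \<phi>"
proof -
  let ?L = "l (e, F)" and ?g = "edge_fun \<phi> e F"
  have le: "\<phi> p \<le> \<phi> q" if "p \<in> min_locus \<Gamma> \<phi>" "q \<in> points \<Gamma>" for p q
    using that by (simp add: min_locus_def)
  have inner: "?g s = ?g t" if "t < ?L"
    by (rule ipl_min_const[OF R_spaceD[OF R F] _ t(1) that s])
      (use le[OF t(3)] edge_point_in_points[OF F] in \<open>auto simp: edge_fun_def\<close>)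
  have outer: "?g s = ?g t" if tL: "t = ?L"
  proof -
    have lnF: "lvert F \<in> min_locus \<Gamma> \<phi>" using t(3) edge_point_simps(2)[OF F] tL by simp
    have minL: "edge_fun \<phi> d F (l (d, F)) \<le> edge_fun \<phi> d F s" if "d \<in> F" for d s
      using le[OF lnF] edge_point_in_points[OF F(1) that] edge_point_simps(2)[OF F(1) that]
      by (simp add: edge_fun_def)
    have nonpos: "slope_left (edge_fun \<phi> d F) (l (d, F)) \<le> 0" if "d \<in> F" for d
      by (rule ipl_min_slope_left[OF R_spaceD(1)[OF R F(1) that]])
        (use len_pos[OF F(1) that] minL[OF that] in auto)
    have "0 \<le> D (lvert F) + principal_divisor \<Gamma> \<phi> (lvert F)"
      using R by (simp add: R_space_def effective_def)
    then have "0 \<le> (\<Sum>d\<in>F. slope_left (edge_fun \<phi> d F) (l (d, F)))"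
      using principal_divisor_ln[OF F(1)] by (simp add: cartwright_simps)
    moreover have fF: "finite F"
      using line_psubset[OF F(1)] finite_points by (auto intro: finite_subset)
    \<comment> \<open>At a minimal line vertex all incoming slopes are nonpositive while their sum
      is nonnegative, so the slope along this edge is zero.\<close>
    moreover have "(\<Sum>d\<in>F. slope_left (edge_fun \<phi> d F) (l (d, F))) \<le> slope_left ?g ?L"
      using sum.remove[OF fF F(2), of "\<lambda>d. slope_left (edge_fun \<phi> d F) (l (d, F))"]
        sum_nonpos[of "F - {e}" "\<lambda>d. slope_left (edge_fun \<phi> d F) (l (d, F))"] nonpos by simp
    ultimately have z: "slope_left ?g ?L = 0" using nonpos[OF F(2)] by simp
    show ?thesis
      unfolding tL
      by (rule ipl_min_left_const[OF R_spaceD(1)[OF R F] len_pos[OF F] R_spaceD(2)[OF R F] minL[OF F(2)] z s])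
  qed
  have "?g s = ?g t" using inner outer t(2) by linarith
  then show ?thesis
    using t(3) edge_point_in_points[OF F, of s] by (simp add: min_locus_def edge_fun_def)
qed

lemma ln_in_min_locusD:
  assumes R: "\<phi> \<in> R_space \<Gamma> D" and F: "F \<in> H" "e \<in> F" and m: "lvert F \<in> min_locus \<Gamma> \<phi>"
  shows "s \<in> {0..l (e, F)} \<Longrightarrow> edge_point \<Gamma> (e, F) s \<in> min_locus \<Gamma> \<phi>"
    and "pvert e \<in> min_locus \<Gamma> \<phi>"
proof -
  show *: "edge_point \<Gamma> (e, F) s \<in> min_locus \<Gamma> \<phi>" if "s \<in> {0..l (e, F)}" for s
    by (rule min_locus_edge[OF R F len_pos[OF F] order_refl])
      (use that m edge_point_simps(2)[OF F] in auto)
  show "pvert e \<in> min_locus \<Gamma> \<phi>"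
    using *[of 0] edge_point_simps(1)[OF F] len_pos[OF F] by simp
qed

text \<open>A minimum at the line vertex spreads over all its edges, so the whole component can be
  tested at this one point.\<close>

lemma local_flat_eq:
  assumes R: "\<phi> \<in> R_space \<Gamma> D"
  shows "local_flat M l \<phi> = {F \<in> H. lvert F \<notin> min_locus \<Gamma> \<phi>}"
proof -
  have "levi_component M l F \<subseteq> min_locus \<Gamma> \<phi> \<longleftrightarrow> lvert F \<in> min_locus \<Gamma> \<phi>" if "F \<in> H" for F
    unfolding component_subset_iff[OF that] using ln_in_min_locusD(1)[OF R that] by auto
  then show ?thesis by (auto simp: local_flat_def)
qed

lemma pt_in_min_locus_ex:
  assumes R: "\<phi> \<in> R_space \<Gamma> D"
  shows "\<exists>e\<in>ground M. pvert e \<in> min_locus \<Gamma> \<phi>"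
proof -
  obtain p where p: "p \<in> min_locus \<Gamma> \<phi>" using min_locus_ne[OF R] by auto
  then have "p \<in> points \<Gamma>" by (simp add: min_locus_def)
  then obtain e F t where q: "F \<in> H" "e \<in> F" "t \<in> {0..l (e, F)}" "p = edge_point \<Gamma> (e, F) t"
    by (rule pointE)
  have "edge_point \<Gamma> (e, F) 0 \<in> min_locus \<Gamma> \<phi>"
  proof (cases "t = 0")
    case False
    then show ?thesis using min_locus_edge[OF R q(1,2), of t 0] q p by auto
  qed (use p q in simp)
  then show ?thesis using edge_point_simps(1)[OF q(1,2)] in_line[OF q(1,2)] by auto
qed

text \<open>A zero slope at a minimal point vertex would make the whole edge minimal, including the
  line vertex. Integrality turns a positive slope into one that is at least 1.\<close>

lemma pt_min_slope:
  assumes R: "\<phi> \<in> R_space \<Gamma> D" and F: "F \<in> H" "e \<in> F" and m: "pvert e \<in> min_locus \<Gamma> \<phi>"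
  shows "0 \<le> slope_right (edge_fun \<phi> e F) 0"
    and "F \<in> local_flat M l \<phi> \<Longrightarrow> 1 \<le> slope_right (edge_fun \<phi> e F) 0"
proof -
  have mn: "edge_fun \<phi> e F 0 \<le> edge_fun \<phi> e F s" for s
    using m edge_point_in_points[OF F] edge_point_simps(1)[OF F]
    by (simp add: edge_fun_def min_locus_def)
  show nn: "0 \<le> slope_right (edge_fun \<phi> e F) 0"
    by (rule ipl_min_slope_right[OF R_spaceD(1)[OF R F] order_refl len_pos[OF F] mn])
  show "1 \<le> slope_right (edge_fun \<phi> e F) 0" if "F \<in> local_flat M l \<phi>"
  proof (rule ccontr)
    assume "\<not> ?thesis"
    then have z: "slope_right (edge_fun \<phi> e F) 0 = 0" using nn by simp
    have "edge_fun \<phi> e F (l (e, F)) = edge_fun \<phi> e F 0"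
      by (rule ipl_min_right_const[OF R_spaceD(1)[OF R F] len_pos[OF F] R_spaceD(2)[OF R F] mn z])
        (use len_pos[OF F] in auto)
    then have "lvert F \<in> min_locus \<Gamma> \<phi>"
      using m ln_in_points[OF F(1)] edge_point_simps(1,2)[OF F]
      by (simp add: edge_fun_def min_locus_def)
    then show False using that local_flat_eq[OF R] by simp
  qed
qed

text \<open>Every exceptional line costs at least one unit of outgoing slope and the other lines
  cost a nonnegative amount. With the coefficient 1 of \<open>D\<close> this allows one exception,
  or none if D + div \<phi> still has \<open>e\<close> in its support.\<close>

lemma pt_min_bound:
  assumes R: "\<phi> \<in> R_space \<Gamma> D" and e: "e \<in> ground M" and m: "pvert e \<in> min_locus \<Gamma> \<phi>"
  shows "int (card {F \<in> local_flat M l \<phi>. e \<in> F}) \<le> - principal_divisor \<Gamma> \<phi> (pvert e)"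
proof -
  let ?s = "\<lambda>F. slope_right (edge_fun \<phi> e F) 0"
  have "int (card {F \<in> local_flat M l \<phi>. e \<in> F}) \<le> (\<Sum>F | F \<in> local_flat M l \<phi> \<and> e \<in> F. ?s F)"
    using sum_mono[of "{F \<in> local_flat M l \<phi>. e \<in> F}" "\<lambda>_. 1" ?s] pt_min_slope(2)[OF R _ _ m]
    by (auto simp: local_flat_eq[OF R])
  also have "\<dots> \<le> (\<Sum>F | F \<in> H \<and> e \<in> F. ?s F)"
    by (rule sum_mono2)
      (use finite_lines pt_min_slope(1)[OF R _ _ m] in \<open>auto simp: local_flat_eq[OF R]\<close>)
  finally show ?thesis using principal_divisor_pt[OF e] by simp
qed

lemma local_flat_at_most_one:
  assumes R: "\<phi> \<in> R_space \<Gamma> D" and m: "pvert e \<in> min_locus \<Gamma> \<phi>"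
    and F: "F \<in> local_flat M l \<phi>" "e \<in> F" and G: "G \<in> local_flat M l \<phi>" "e \<in> G"
  shows "F = G"
proof (rule ccontr)
  assume "F \<noteq> G"
  have fin: "finite {F \<in> local_flat M l \<phi>. e \<in> F}"
    by (rule finite_subset[OF _ finite_lines]) (auto simp: local_flat_def)
  have e: "e \<in> ground M" using in_line[OF _ F(2)] F(1) by (simp add: local_flat_def)
  have "card {F, G} \<le> card {F \<in> local_flat M l \<phi>. e \<in> F}"
    by (rule card_mono[OF fin]) (use F G in auto)
  moreover have "0 \<le> D (pvert e) + principal_divisor \<Gamma> \<phi> (pvert e)"
    using R by (simp add: R_space_def effective_def)
  ultimately show False
    using pt_min_bound[OF R e m] \<open>F \<noteq> G\<close> by (simp add: cartwright_simps(1)[OF e])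
qed

lemma local_flat_none:
  assumes R: "\<phi> \<in> R_space \<Gamma> D" and e: "e \<in> ground M" and m: "pvert e \<in> min_locus \<Gamma> \<phi>"
    and "0 \<le> principal_divisor \<Gamma> \<phi> (pvert e)" "F \<in> local_flat M l \<phi>"
  shows "e \<notin> F"
proof -
  have "finite {F \<in> local_flat M l \<phi>. e \<in> F}"
    by (rule finite_subset[OF _ finite_lines]) (auto simp: local_flat_def)
  moreover have "card {F \<in> local_flat M l \<phi>. e \<in> F} = 0"
    using pt_min_bound[OF R e m] assms(4) by simp
  ultimately have "{F \<in> local_flat M l \<phi>. e \<in> F} = {}"
    by (simp only: card_0_eq)
  then show ?thesis using assms(5) by blast
qed

text \<open>If the line vertex were minimal, \<open>\<phi>\<close> would be constant on all edges at
  it and its divisor would vanish there.\<close>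

lemma in_local_flatI:
  assumes R: "\<phi> \<in> R_space \<Gamma> D" and F: "F \<in> H" and p: "1 \<le> principal_divisor \<Gamma> \<phi> (lvert F)"
  shows "F \<in> local_flat M l \<phi>"
proof (rule ccontr)
  assume "F \<notin> local_flat M l \<phi>"
  then have m: "lvert F \<in> min_locus \<Gamma> \<phi>" using local_flat_eq[OF R] F by simp
  have "slope_left (edge_fun \<phi> e F) (l (e, F)) = 0" if e: "e \<in> F" for e
  proof (rule slope_left_eqI[OF len_pos[OF F e]])
    fix s assume "s \<in> {l (e, F) - l (e, F)..l (e, F)}"
    then have "edge_point \<Gamma> (e, F) s \<in> min_locus \<Gamma> \<phi>" using ln_in_min_locusD(1)[OF R F e m] by simp
    then show "edge_fun \<phi> e F s = edge_fun \<phi> e F (l (e, F)) + of_int 0 * (s - l (e, F))"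
      using m edge_point_simps(2)[OF F e] by (auto simp: edge_fun_def min_locus_def intro: antisym)
  qed
  then show False using p principal_divisor_ln[OF F] by simp
qed

text \<open>Every edge ends at a line vertex, which is now minimal, so \<open>\<phi>\<close> is
  constant on the graph. This is how \<open>D\<close> itself enters the linear system.\<close>

lemma principal_divisor_zero:
  assumes R: "\<phi> \<in> R_space \<Gamma> D" and empty: "local_flat M l \<phi> = {}"
  shows "principal_divisor \<Gamma> \<phi> p = 0"
proof -
  have min: "p \<in> min_locus \<Gamma> \<phi>" if "p \<in> points \<Gamma>" for p
    using that
  proof (rule pointE)
    fix e F t assume q: "F \<in> H" "e \<in> F" "t \<in> {0..l (e, F)}" "p = edge_point \<Gamma> (e, F) t"
    then show ?thesis using ln_in_min_locusD(1)[OF R q(1,2)] empty local_flat_eq[OF R] by auto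
  qed
  obtain q where q: "q \<in> min_locus \<Gamma> \<phi>" using min_locus_ne[OF R] by auto
  have c: "\<phi> p = \<phi> q" if "p \<in> points \<Gamma>" for p
    using min[OF that] q by (auto simp: min_locus_def intro: antisym)
  have "\<phi> (edge_point \<Gamma> k s) = \<phi> q" if "k \<in> edges \<Gamma>" for k s
    using that by (intro c) (auto simp: levi_graph_def intro: edge_point_in_points[unfolded levi_graph_def])
  note sl = slope_const[of "\<lambda>s. \<phi> (edge_point \<Gamma> _ s)", OF this]
  have "k \<in> edges \<Gamma>" if "Interior k t \<in> points \<Gamma>" for k t
    using that by (auto simp: points_def edge_interior_def)
  then show ?thesis
    unfolding principal_divisor_def by (auto split: point.split simp: sl)
qed

lemma min_value_ex:
  assumes R: "\<phi> \<in> R_space \<Gamma> D"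
  shows "\<exists>m. (\<forall>p\<in>points \<Gamma>. m \<le> \<phi> p) \<and> (\<forall>p\<in>points \<Gamma>. \<phi> p = m \<longleftrightarrow> p \<in> min_locus \<Gamma> \<phi>)"
proof -
  obtain q where q: "q \<in> min_locus \<Gamma> \<phi>" using min_locus_ne[OF R] by auto
  then have "min_locus \<Gamma> \<phi> = {p \<in> points \<Gamma>. \<phi> p = \<phi> q}"
    by (intro min_locus_eq) (auto simp: min_locus_def)
  then show ?thesis using q by (intro exI[of _ "\<phi> q"]) (auto simp: min_locus_def)
qed

section \<open>Consequences of the axioms of a tropical linear series\<close>

lemma local_flat_Int:
  assumes sub: "tropical_submodule \<Gamma> D \<Sigma>" and "\<phi> \<in> \<Sigma>" "\<psi> \<in> \<Sigma>"
  shows "\<exists>\<rho>\<in>\<Sigma>. local_flat M l \<rho> = local_flat M l \<phi> \<inter> local_flat M l \<psi>"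
proof -
  have R: "\<Sigma> \<subseteq> R_space \<Gamma> D" using sub by (simp add: tropical_submodule_def)
  obtain m where m: "\<And>p. p \<in> points \<Gamma> \<Longrightarrow> m \<le> \<phi> p"
    "\<And>p. p \<in> points \<Gamma> \<Longrightarrow> \<phi> p = m \<longleftrightarrow> p \<in> min_locus \<Gamma> \<phi>"
    using min_value_ex[of \<phi>] R assms(2) by blast
  obtain n where n: "\<And>p. p \<in> points \<Gamma> \<Longrightarrow> n \<le> \<psi> p"
    "\<And>p. p \<in> points \<Gamma> \<Longrightarrow> \<psi> p = n \<longleftrightarrow> p \<in> min_locus \<Gamma> \<psi>"
    using min_value_ex[of \<psi>] R assms(3) by blast
  \<comment> \<open>Both minimum values are shifted to 0, so that the pointwise minimum attains 0 on
    the union of the two loci. Taking complements turns this union into an intersection of local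
    flats.\<close>
  let ?\<phi> = "\<lambda>p\<in>points \<Gamma>. \<phi> p + - m" and ?\<psi> = "\<lambda>p\<in>points \<Gamma>. \<psi> p + - n"
  define \<rho> where "\<rho> = (\<lambda>p\<in>points \<Gamma>. min (?\<phi> p) (?\<psi> p))"
  have "?\<phi> \<in> \<Sigma>" "?\<psi> \<in> \<Sigma>"
    using sub assms(2,3) unfolding tropical_submodule_def by blast+
  then have \<rho>: "\<rho> \<in> \<Sigma>"
    using sub unfolding tropical_submodule_def \<rho>_def by blast
  obtain q where q: "q \<in> min_locus \<Gamma> \<phi>" using min_locus_ne[of \<phi>] R assms(2) by auto
  then have qp: "q \<in> points \<Gamma>" by (simp add: min_locus_def)
  have "\<rho> q = 0" using m(2)[OF qp] n(1)[OF qp] q qp by (simp add: \<rho>_def)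
  moreover have "0 \<le> \<rho> p" if "p \<in> points \<Gamma>" for p
    using m(1)[OF that] n(1)[OF that] that by (simp add: \<rho>_def)
  ultimately have "min_locus \<Gamma> \<rho> = {p \<in> points \<Gamma>. \<rho> p = 0}"
    using min_locus_eq[OF _ qp] by blast
  also have "\<dots> = min_locus \<Gamma> \<phi> \<union> min_locus \<Gamma> \<psi>"
  proof (intro set_eqI)
    fix p
    show "p \<in> {p \<in> points \<Gamma>. \<rho> p = 0} \<longleftrightarrow> p \<in> min_locus \<Gamma> \<phi> \<union> min_locus \<Gamma> \<psi>"
    proof (cases "p \<in> points \<Gamma>")
      case True
      then show ?thesis using m[OF True] n[OF True] by (auto simp: \<rho>_def min_def)
    qed (auto simp: min_locus_def)
  qed
  finally have "local_flat M l \<rho> = local_flat M l \<phi> \<inter> local_flat M l \<psi>"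
    using \<rho> R assms(2,3) by (auto simp: local_flat_eq subset_iff)
  then show ?thesis using \<rho> by blast
qed

text \<open>The case \<open>a = b\<close> is included and prescribes a point with multiplicity two;
  the sum of two indicators covers both cases at once.\<close>

lemma BN_two:
  assumes "BN_property \<Gamma> D \<Sigma> 2" "a \<in> points \<Gamma>" "b \<in> points \<Gamma>"
  shows "\<exists>\<phi>\<in>\<Sigma>. \<forall>p. of_bool (p = a) + of_bool (p = b) \<le> D p + principal_divisor \<Gamma> \<phi> p"
proof -
  define D' :: "('a + 'a set, 'a \<times> 'a set) point \<Rightarrow> int"
    where "D' = (\<lambda>p. of_bool (p = a) + of_bool (p = b))"
  have supp: "{p. D' p \<noteq> 0} = {a, b}" by (auto simp: D'_def)
  have "D' \<in> divisors \<Gamma>" using assms(2,3) by (simp add: divisors_def supp)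
  moreover have "effective D'" by (simp add: effective_def D'_def)
  moreover have "divisor_degree D' = 2"
    unfolding divisor_degree_def supp by (cases "a = b") (auto simp: D'_def)
  ultimately obtain \<phi> where "\<phi> \<in> \<Sigma>" "effective (\<lambda>p. D p - D' p + principal_divisor \<Gamma> \<phi> p)"
    using assms(1) unfolding BN_property_def by blast
  then show ?thesis by (intro bexI[of _ \<phi>]) (auto simp: effective_def D'_def algebra_simps)
qed

text \<open>For any choice of constants there is a line vertex at which the minimum is attained by
  one function only. It lies in the minimum locus of a function with smallest local flat among those
  of lowest shifted minimum.\<close>

lemma independent_if_chain:
  assumes "finite S" "S \<subseteq> R_space \<Gamma> D" "inj_on (local_flat M l) S"
    and chain: "\<And>\<phi> \<psi>. \<phi> \<in> S \<Longrightarrow> \<psi> \<in> S \<Longrightarrow>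
      local_flat M l \<phi> \<subseteq> local_flat M l \<psi> \<or> local_flat M l \<psi> \<subseteq> local_flat M l \<phi>"
  shows "\<not> tropically_dependent \<Gamma> S"
proof
  let ?X = "local_flat M l"
  assume "tropically_dependent \<Gamma> S"
  then obtain a where a: "\<And>p. p \<in> points \<Gamma> \<Longrightarrow> \<exists>\<phi>\<in>S. \<exists>\<psi>\<in>S.
        \<phi> \<noteq> \<psi> \<and> \<phi> p + a \<phi> = \<psi> p + a \<psi> \<and> (\<forall>\<rho>\<in>S. \<phi> p + a \<phi> \<le> \<rho> p + a \<rho>)"
    unfolding tropically_dependent_def by blast
  have "\<forall>\<phi>\<in>S. \<exists>m. (\<forall>p\<in>points \<Gamma>. m \<le> \<phi> p) \<and> (\<forall>p\<in>points \<Gamma>. \<phi> p = m \<longleftrightarrow> p \<in> min_locus \<Gamma> \<phi>)"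
    using min_value_ex assms(2) by blast
  then obtain m where m: "\<And>\<phi> p. \<phi> \<in> S \<Longrightarrow> p \<in> points \<Gamma> \<Longrightarrow> m \<phi> \<le> \<phi> p"
    "\<And>\<phi> p. \<phi> \<in> S \<Longrightarrow> p \<in> points \<Gamma> \<Longrightarrow> \<phi> p = m \<phi> \<longleftrightarrow> p \<in> min_locus \<Gamma> \<phi>"
    by metis
  define b where "b \<phi> = m \<phi> + a \<phi>" for \<phi>
  have val: "b \<phi> \<le> \<phi> (lvert F) + a \<phi>" "\<phi> (lvert F) + a \<phi> = b \<phi> \<longleftrightarrow> F \<notin> ?X \<phi>" if "\<phi> \<in> S" "F \<in> H" for \<phi> F
    using m[OF that(1) ln_in_points[OF that(2)]] that assms(2)
    by (auto simp: b_def local_flat_eq subset_iff)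
  obtain e where "e \<in> ground M" using two_points by auto
  then have Hne: "H \<noteq> {}" using two_lines_through by blast
  then have "S \<noteq> {}" using a ln_in_points by blast
  define c where "c = Min (b ` S)"
  define T where "T = {\<phi> \<in> S. b \<phi> = c}"
  have c: "c \<le> b \<phi>" if "\<phi> \<in> S" for \<phi> using that assms(1) by (simp add: c_def)
  have "finite T" using assms(1) by (simp add: T_def)
  have "c \<in> b ` S" unfolding c_def using assms(1) \<open>S \<noteq> {}\<close> by (intro Min_in) auto
  then have "T \<noteq> {}" by (auto simp: T_def)
  have fin: "finite (?X \<phi>)" for \<phi>
    by (rule finite_subset[OF _ finite_lines]) (auto simp: local_flat_def)
  have least: "\<exists>\<phi>\<in>U. \<forall>\<psi>\<in>U. ?X \<phi> \<subseteq> ?X \<psi>" if U: "U \<subseteq> S" "U \<noteq> {}" for U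
  proof -
    obtain \<phi> where "\<phi> \<in> U" "\<forall>\<psi>\<in>U. card (?X \<phi>) \<le> card (?X \<psi>)"
      using ex_has_least_nat[of "\<lambda>\<phi>. \<phi> \<in> U" _ "\<lambda>\<phi>. card (?X \<phi>)"] U(2) by blast
    moreover have "?X \<phi> \<subseteq> ?X \<psi>" if "\<phi> \<in> U" "\<psi> \<in> U" "card (?X \<phi>) \<le> card (?X \<psi>)" for \<phi> \<psi>
    proof -
      have "?X \<phi> \<subseteq> ?X \<psi> \<or> ?X \<psi> \<subseteq> ?X \<phi>" using chain U(1) that(1,2) by blast
      then show ?thesis using card_seteq[OF fin _ that(3)] by blast
    qed
    ultimately show ?thesis by blast
  qed
  obtain \<phi> where \<phi>: "\<phi> \<in> T" "\<And>\<psi>. \<psi> \<in> T \<Longrightarrow> ?X \<phi> \<subseteq> ?X \<psi>"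
    using least[of T] \<open>T \<noteq> {}\<close> by (auto simp: T_def)
  \<comment> \<open>If \<open>\<phi>\<close> is alone in \<open>T\<close>, any line outside its
    local flat will do, and a minimal point has one through it. Otherwise the line comes from the
    difference between the second smallest local flat and the smallest.\<close>
  have "\<exists>F\<in>H. F \<notin> ?X \<phi> \<and> (\<forall>\<psi>\<in>T - {\<phi>}. F \<in> ?X \<psi>)"
  proof (cases "T - {\<phi>} = {}")
    case True
    obtain d where d: "d \<in> ground M" "pvert d \<in> min_locus \<Gamma> \<phi>"
      using pt_in_min_locus_ex[of \<phi>] \<phi>(1) assms(2) by (auto simp: T_def)
    obtain F G where "F \<in> H" "G \<in> H" "F \<noteq> G" "d \<in> F" "d \<in> G" using two_lines_through[OF d(1)] .
    then have "F \<notin> ?X \<phi> \<or> G \<notin> ?X \<phi>"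
      using local_flat_at_most_one[of \<phi> d F G] d \<phi>(1) assms(2) by (auto simp: T_def)
    then show ?thesis using True \<open>F \<in> H\<close> \<open>G \<in> H\<close> by blast
  next
    case False
    have TS: "T - {\<phi>} \<subseteq> S" by (auto simp: T_def)
    obtain \<psi> where \<psi>: "\<psi> \<in> T - {\<phi>}" "\<And>\<rho>. \<rho> \<in> T - {\<phi>} \<Longrightarrow> ?X \<psi> \<subseteq> ?X \<rho>"
      using least[OF TS False] by blast
    have "?X \<phi> \<noteq> ?X \<psi>" using \<psi>(1) \<phi>(1) assms(3) by (auto simp: T_def dest: inj_onD)
    then obtain F where F: "F \<in> ?X \<psi>" "F \<notin> ?X \<phi>" using \<phi>(2)[of \<psi>] \<psi>(1) by blast
    have "F \<in> H" using F(1) by (simp add: local_flat_def)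
    moreover have "\<forall>\<rho>\<in>T - {\<phi>}. F \<in> ?X \<rho>" using F(1) \<psi>(2) by blast
    ultimately show ?thesis using F(2) by blast
  qed
  then obtain F where F: "F \<in> H" "F \<notin> ?X \<phi>" "\<And>\<psi>. \<psi> \<in> T \<Longrightarrow> \<psi> \<noteq> \<phi> \<Longrightarrow> F \<in> ?X \<psi>"
    by blast
  have \<phi>S: "\<phi> \<in> S" "\<phi> (lvert F) + a \<phi> = c" using \<phi>(1) val(2)[of \<phi> F] F by (auto simp: T_def)
  \<comment> \<open>Functions in \<open>T\<close> are above their minimum at \<open>F\<close>; those
    outside \<open>T\<close> have a minimum above \<open>c\<close> already.\<close>
  have gt: "c < \<psi> (lvert F) + a \<psi>" if "\<psi> \<in> S" "\<psi> \<noteq> \<phi>" for \<psi>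
    using val[OF that(1) F(1)] c[OF that(1)] F(3)[of \<psi>] that
    by (cases "\<psi> \<in> T") (auto simp: T_def)
  show False
    using a[OF ln_in_points[OF F(1)]] gt \<phi>S by (metis not_le)
qed

text \<open>One function is chosen for each member of the chain; these representatives are
  independent, so the independence rank bounds the chain.\<close>

lemma local_flats_chain_card:
  assumes "\<Sigma> \<subseteq> R_space \<Gamma> D" "has_ind_rank \<Gamma> \<Sigma> n" "subset.chain (local_flat M l ` \<Sigma>) C"
  shows "card C \<le> n"
proof -
  have "C \<subseteq> local_flat M l ` \<Sigma>" using assms(3) by (simp add: subset.chain_def)
  then obtain S where S: "S \<subseteq> \<Sigma>" "inj_on (local_flat M l) S" "C = local_flat M l ` S"
    by (meson subset_image_inj)
  have "finite C"
    by (rule finite_subset[of _ "Pow H"]) (use S(3) finite_lines in \<open>auto simp: local_flat_def\<close>)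
  then have "finite S" using S finite_image_iff by blast
  moreover have "\<not> tropically_dependent \<Gamma> S"
  proof (rule independent_if_chain[OF \<open>finite S\<close> _ S(2)])
    show "S \<subseteq> R_space \<Gamma> D" using S(1) assms(1) by (rule subset_trans)
  next
    fix \<phi> \<psi> assume "\<phi> \<in> S" "\<psi> \<in> S"
    then have "local_flat M l \<phi> \<in> C" "local_flat M l \<psi> \<in> C" using S(3) by auto
    then show "local_flat M l \<phi> \<subseteq> local_flat M l \<psi> \<or> local_flat M l \<psi> \<subseteq> local_flat M l \<phi>"
      using assms(3) unfolding subset_chain_def by blast
  qed
  ultimately show ?thesis
    using assms(2) S card_image[OF S(2)] unfolding has_ind_rank_def by auto
qed

lemma minima_system:
  assumes "tropical_linear_series \<Gamma> D 2 \<Sigma>"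
  shows "minima_system (ground M) H \<Sigma> (\<lambda>\<phi>. {e. pvert e \<in> min_locus \<Gamma> \<phi>}) (local_flat M l)"
proof -
  have sub: "tropical_submodule \<Gamma> D \<Sigma>" and BN: "BN_property \<Gamma> D \<Sigma> 2" and ind: "has_ind_rank \<Gamma> \<Sigma> 3"
    using assms by (simp_all add: tropical_linear_series_def has_BN_rank_def)
  have R: "\<phi> \<in> R_space \<Gamma> D" if "\<phi> \<in> \<Sigma>" for \<phi>
    using sub that by (auto simp: tropical_submodule_def)
  note BN2 = BN_two[OF BN]
  show ?thesis
  proof
    fix \<phi> show "local_flat M l \<phi> \<subseteq> H" by (auto simp: local_flat_def)
  next
    fix \<phi> F e assume "\<phi> \<in> \<Sigma>" "F \<in> H" "F \<notin> local_flat M l \<phi>" "e \<in> F"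
    then show "e \<in> {e. pvert e \<in> min_locus \<Gamma> \<phi>}"
      using ln_in_min_locusD(2)[OF R] local_flat_eq[OF R] by auto
  next
    fix \<phi> e F G
    assume "\<phi> \<in> \<Sigma>" "e \<in> {e. pvert e \<in> min_locus \<Gamma> \<phi>}" "F \<in> local_flat M l \<phi>" "G \<in> local_flat M l \<phi>" "e \<in> F" "e \<in> G"
    then show "F = G" using local_flat_at_most_one[OF R] by auto
  next
    fix \<phi> assume "\<phi> \<in> \<Sigma>"
    then show "\<exists>e\<in>ground M. e \<in> {e. pvert e \<in> min_locus \<Gamma> \<phi>}" using pt_in_min_locus_ex[OF R] by auto
  next
    fix \<phi> \<psi> assume "\<phi> \<in> \<Sigma>" "\<psi> \<in> \<Sigma>"
    then show "\<exists>\<rho>\<in>\<Sigma>. local_flat M l \<rho> = local_flat M l \<phi> \<inter> local_flat M l \<psi>"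
      by (rule local_flat_Int[OF sub])
  next
    fix F G assume FG: "F \<in> H" "G \<in> H"
    then obtain \<phi> where \<phi>: "\<phi> \<in> \<Sigma>"
      and b: "\<And>p. of_bool (p = lvert F) + of_bool (p = lvert G) \<le> D p + principal_divisor \<Gamma> \<phi> p"
      using BN2[OF ln_in_points ln_in_points] by blast
    have "F \<in> local_flat M l \<phi>" "G \<in> local_flat M l \<phi>"
      using b[of "lvert F"] b[of "lvert G"]
      by (auto intro!: in_local_flatI[OF R[OF \<phi>]] FG simp: cartwright_simps of_bool_def split: if_splits)
    then show "\<exists>\<phi>\<in>\<Sigma>. F \<in> local_flat M l \<phi> \<and> G \<in> local_flat M l \<phi>" using \<phi> by blast
  next
    fix F g assume Fg: "F \<in> H" "g \<in> ground M"
    then obtain \<phi> where \<phi>: "\<phi> \<in> \<Sigma>"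
      and b: "\<And>p. of_bool (p = lvert F) + of_bool (p = pvert g) \<le> D p + principal_divisor \<Gamma> \<phi> p"
      using BN2[OF ln_in_points pt_in_points] by blast
    have "F \<in> local_flat M l \<phi>"
      using b[of "lvert F"] by (intro in_local_flatI[OF R[OF \<phi>] Fg(1)]) (simp add: cartwright_simps)
    \<comment> \<open>\<open>D\<close> already has coefficient 1 at \<open>g\<close>, so prescribing
      \<open>g\<close> says only that \<open>\<phi>\<close> removes nothing there.\<close>
    moreover have "0 \<le> principal_divisor \<Gamma> \<phi> (pvert g)"
      using b[of "pvert g"] by (simp add: cartwright_simps Fg)
    ultimately show "\<exists>\<phi>\<in>\<Sigma>. F \<in> local_flat M l \<phi> \<and>
        (g \<in> {e. pvert e \<in> min_locus \<Gamma> \<phi>} \<longrightarrow> (\<forall>G\<in>local_flat M l \<phi>. g \<notin> G))"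
      using \<phi> local_flat_none[OF R[OF \<phi>] Fg(2)] by blast
  next
    fix e f assume ef: "e \<in> ground M" "f \<in> ground M"
    then obtain \<phi> where \<phi>: "\<phi> \<in> \<Sigma>"
      and b: "\<And>p. of_bool (p = pvert e) + of_bool (p = pvert f) \<le> D p + principal_divisor \<Gamma> \<phi> p"
      using BN2[OF pt_in_points pt_in_points] by blast
    have "0 \<le> principal_divisor \<Gamma> \<phi> (pvert e)" "0 \<le> principal_divisor \<Gamma> \<phi> (pvert f)"
      using b[of "pvert e"] b[of "pvert f"] ef
      by (auto simp: cartwright_simps of_bool_def split: if_splits)
    then show "\<exists>\<phi>\<in>\<Sigma>. (e \<in> {e. pvert e \<in> min_locus \<Gamma> \<phi>} \<longrightarrow> (\<forall>G\<in>local_flat M l \<phi>. e \<notin> G)) \<and>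
        (f \<in> {e. pvert e \<in> min_locus \<Gamma> \<phi>} \<longrightarrow> (\<forall>G\<in>local_flat M l \<phi>. f \<notin> G))"
      using \<phi> local_flat_none[OF R[OF \<phi>]] ef by (intro bexI[of _ \<phi>]) auto
  next
    fix C assume "subset.chain (local_flat M l ` \<Sigma>) C"
    then show "card C \<le> 3" using local_flats_chain_card[OF _ ind] R by blast
  qed
qed

end

theorem theorem7p1:
  fixes M :: "'a matroid"
    and l :: "'a \<times> 'a set \<Rightarrow> real"
    and \<Sigma> :: "(('a + 'a set, 'a \<times> 'a set) point \<Rightarrow> real) set"
  assumes "simple_matroid M" and "matroid_rank M = 3"
    and "\<And>e F. F \<in> rank_flats M 2 \<Longrightarrow> e \<in> F \<Longrightarrow> l (e, F) > 0"
    and "tropical_linear_series (levi_graph M l) (cartwright_divisor M) 2 \<Sigma>"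
  shows "cartwright_divisor M \<in> linear_system (levi_graph M l) (cartwright_divisor M) \<Sigma> \<and>
    is_adjoint M (local_matroid M l \<Sigma>)"
proof
  interpret levi M l
    using rank3_linear_space(1)[OF assms(1,2)] assms(3) by (simp add: levi_def levi_axioms_def)
  note sys = minima_system[OF assms(4)]
  obtain \<phi> where "\<phi> \<in> \<Sigma>" "local_flat M l \<phi> = {}"
    using minima_system.empty_flat[OF sys] by auto
  moreover have "\<Sigma> \<subseteq> R_space \<Gamma> D"
    using assms(4) by (simp add: tropical_linear_series_def tropical_submodule_def)
  ultimately show "D \<in> linear_system \<Gamma> D \<Sigma>"
    unfolding linear_system_def using principal_divisor_zero[of \<phi>] by force
  show "is_adjoint M (local_matroid M l \<Sigma>)"
    unfolding local_matroid_def by (rule minima_system_adjoint[OF assms(1,2) sys])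
qed

end
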